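(* Let $\beta<\alpha\in\omega_1\cup\{\mathbb{N}\}$, where $\beta$ is a countable ordinal. Then: 1. $\mathsf{RT}^1_{\alpha,\beta}$ has a rank-$\beta$ discontinuity, and 2. $\mathsf{RT}^1_{\alpha,\beta}$ does not have a rank-$\gamma$ discontinuity for any $\gamma<\beta$.
   Context: **Convention.** The symbol $\mathbb{N}$, as a value of the parameter $\alpha$, counts as larger than every countable ordinal: $\beta<\mathbb{N}$ holds for all $\beta<\omega_1$. **Problems.** $\mathbb{N}^{\mathbb{N}}$ is Baire space; $\sigma\sqsubseteq x$ means $\sigma$ is an initial segment of $x$, and $[\![\sigma]\!]$ is the set of infinite sequences extending the finite string $\sigma$. Identify $(\mathbb{N}\cup\{\#\})^{\mathbb{N}}$ with $\mathbb{N}^{\mathbb{N}}$ via $\#\mapsto0$, $n\mapsto n+1$. A problem $P:\subseteq\mathbb{N}^{\mathbb{N}}\rightrightarrows\mathbb{N}^{\mathbb{N}}$ is a partial multivalued function with instances $\mathrm{dom}(P)$ and solution sets $P(p)$, possibly empty. $P|_A$ has domain $\mathrm{dom}(P)\cap A$; $P|[A\times B]$ has domain $\mathrm{dom}(P)\cap A$ and $P|[A\times B](x)=P(x)\cap B$. $P$ is continuous if some continuous partial function $\Phi$ defined on $\mathrm{dom}(P)$ satisfies $\Phi(p)\in P(p)$ for all $p\in\mathrm{dom}(P)$. $p\in\mathrm{dom}(P)$ is a discontinuity of $P$ if $P|_U$ is not continuous for every open neighborhood $U$ of $p$. **Rank of discontinuity.** Let $p$ be a discontinuity of $P$. If $P(p)=\emptyset$,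 $p$ is a rank-$0$ discontinuity. For countable $\alpha>0$ (and $P(p)\neq\emptyset$), $p$ is a rank-$\alpha$ discontinuity if $\alpha$ is the least ordinal such that for all $q\in P(p)$ there is a finite $\rho\sqsubseteq q$ such that for all finite $\sigma\sqsubseteq p$ there is $p'\in\mathrm{dom}(P)\cap[\![\sigma]\!]$, $p'\ne p$, which is a rank-$\beta$ discontinuity of $P|[[\![\sigma]\!]\times[\![\rho]\!]]$ for some $\beta<\alpha$. **The problems $\mathsf{RT}^n_{\alpha,\beta}$** ($n\ge1$). Fix a bijection $\langle\cdot\rangle:[\mathbb{N}]^n\to\mathbb{N}$, where $[A]^n$ is the set of $n$-element subsets of $A$; a coloring $c:[\mathbb{N}]^n\to\mathbb{N}$ is identified with the sequence $c\in\mathbb{N}^{\mathbb{N}}$, $c(\langle a_0,\dots,a_{n-1}\rangle)=c(a_0,\dots,a_{n-1})$. A set $A\subseteq\mathbb{N}$ is identified with its characteristic sequence, and a finite $0$–$1$ string $\phi$ with $\{i:\phi(i)=1\}$. For each $0<\gamma<\omega_1$ fix an enumeration (surjection, repetitions allowed) $w_\gamma:\mathbb{N}\to\gamma$, computable if $\gamma<\omega$. For a countable ordinal $\alpha$ and $\vec v=v_0\dots v_{k-1}\in\mathbb{N}^{<\mathbb{N}}$, put $s_\alpha(\vec v)=\gamma_0\dots\gamma_{k-1}$ where $\gamma_{-1}=\alpha$ and $\gamma_i=w_{\gamma_{i-1}}(v_i)$; it is undefined if some needed $w_{\gamma_{i-1}}$ has $\gamma_{i-1}=0$. So $s_\alpha(\vec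 v)$ is a strictly decreasing sequence of ordinals below $\alpha$. *Instances, $\alpha<\omega_1$.* Index $i$ adds a new color to $c$ if $c(i)\notin\{c(j):j<i\}$. If $c$ has exactly $k$ colors, first appearing at indices $m_0<\dots<m_{k-1}$, write $c=\theta_0\theta_1\cdots\theta_{k-1}r$ with $\theta_0\cdots\theta_i=c|_{m_i+1}$. For $\vec v=v_0\dots v_{k-1}\in\mathrm{dom}(s_\alpha)$ the sequence $\theta_0\#v_0\theta_1\#v_1\cdots\theta_{k-1}\#v_{k-1}r\in(\mathbb{N}\cup\{\#\})^{\mathbb{N}}$ is a name of $(c,s_\alpha(\vec v))$. The instances of $\mathsf{RT}^n_{\alpha,\beta}$ are all such names, for all colorings $c$ with finitely many (say $k$) colors and all $\vec v\in\mathrm{dom}(s_\alpha)$ of length $k$. *Instances, $\alpha=\mathbb{N}$.* The instances of $\mathsf{RT}^n_{\mathbb{N},\beta}$ are the colorings $c:[\mathbb{N}]^n\to\mathbb{N}$ with finite range. *Solutions, $\beta<\omega_1$.* The solutions to an instance with coloring $c$ are all sequences $\phi_0\#v_0\phi_1\#v_1\cdots\phi_{k-1}\#v_{k-1}q$ such that $\phi_0\phi_1\cdots\phi_{k-1}q$ is (the characteristic sequence of) an infinite set $A\subseteq\mathbb{N}$ with $|c([A]^n)|\le k$, $\vec v=v_0\dots v_{k-1}\in\mathrm{dom}(s_\beta)$, and $|c([\phi_0\cdots\phi_{i-1}]^n)|\le i$ for all $i\le k$. *)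

theory Defs
  imports
    "HOL-Analysis.Analysis"
    "HOL-Library.Omega_Words_Fun"
    "HOL-Library.Ramsey"
    "HOL-Library.Countable_Set_Type"
begin

text \<open>
  \<^term>\<open>cardSuc natLeq\<close> is a well-order of order type $\omega_1$; its field is turned into a type
  of class wellorder. The lemmas \<open>countable_below\<close> and \<open>uncountable_omega1\<close> characterise this
  type up to order isomorphism. An ordinal $\gamma$ is identified with \<^term>\<open>{..<\<gamma>}\<close>.
\<close>

unbundle cardinal_syntax

lemma cardSuc_natLeq_greater: "natLeq <o cardSuc natLeq"
  using cardSuc_greater natLeq_Card_order by blast

lemma Well_order_cardSuc_natLeq: "Well_order (cardSuc natLeq)"
  using cardSuc_Card_order[OF natLeq_Card_order] card_order_on_well_order_on by blast

lemma Field_cardSuc_natLeq_not_countable: "\<not> countable (Field (cardSuc natLeq))"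
proof
  assume "countable (Field (cardSuc natLeq))"
  then have "|Field (cardSuc natLeq)| \<le>o natLeq"
    using countable_card_of_nat card_of_nat ordLeq_ordIso_trans by blast
  moreover have "|Field (cardSuc natLeq)| =o cardSuc natLeq"
    using card_of_Field_ordIso[OF cardSuc_Card_order[OF natLeq_Card_order]] .
  ultimately have "cardSuc natLeq \<le>o natLeq"
    using ordIso_symmetric ordIso_ordLeq_trans by blast
  with cardSuc_natLeq_greater show False
    using not_ordLess_ordLeq by blast
qed

typedef omega1 = "Field (cardSuc natLeq)"
  using Field_cardSuc_natLeq_not_countable by (metis countable_empty ex_in_conv)

instantiation omega1 :: wellorder
begin

definition less_eq_omega1 :: "omega1 \<Rightarrow> omega1 \<Rightarrow> bool"
  where "x \<le> y \<longleftrightarrow> (Rep_omega1 x, Rep_omega1 y) \<in> cardSuc natLeq"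

definition less_omega1 :: "omega1 \<Rightarrow> omega1 \<Rightarrow> bool"
  where "x < y \<longleftrightarrow> x \<le> y \<and> \<not> y \<le> (x::omega1)"

instance
proof -
  note wo = Well_order_cardSuc_natLeq
  have r: "refl_on (Field (cardSuc natLeq)) (cardSuc natLeq)"
    and t: "trans (cardSuc natLeq)" and a: "antisym (cardSuc natLeq)"
    and tot: "Total (cardSuc natLeq)" and wf: "wf (cardSuc natLeq - Id)"
    using wo by (auto simp: well_order_on_def linear_order_on_def partial_order_on_def
        preorder_on_def)
  show "OFCLASS(omega1, wellorder_class)"
  proof (intro_classes)
    fix x y z :: omega1
    show "x < y \<longleftrightarrow> x \<le> y \<and> \<not> y \<le> x" by (rule less_omega1_def)
    show "x \<le> x"
      using r Rep_omega1 by (auto simp: less_eq_omega1_def refl_on_def)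
    show "x \<le> y \<Longrightarrow> y \<le> z \<Longrightarrow> x \<le> z"
      using t by (auto simp: less_eq_omega1_def trans_def)
    show "x \<le> y \<Longrightarrow> y \<le> x \<Longrightarrow> x = y"
      using a by (metis less_eq_omega1_def antisym_def Rep_omega1_inject)
    show "x \<le> y \<or> y \<le> x"
      using tot r Rep_omega1[of x] Rep_omega1[of y]
      unfolding less_eq_omega1_def total_on_def refl_on_def by metis
  next
    fix P :: "omega1 \<Rightarrow> bool" and x
    assume step: "\<And>x. (\<And>y. y < x \<Longrightarrow> P y) \<Longrightarrow> P x"
    have "wf (inv_image (cardSuc natLeq - Id) Rep_omega1)"
      using wf by (rule wf_inv_image)
    then show "P x"
    proof (induction x rule: wf_induct_rule)
      case (less x)
      show ?case
      proof (rule step)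
        fix y :: omega1
        assume "y < x"
        then have "(y, x) \<in> inv_image (cardSuc natLeq - Id) Rep_omega1"
          by (auto simp: less_omega1_def less_eq_omega1_def in_inv_image)
        then show "P y" by (rule less.IH)
      qed
    qed
  qed
qed

end

instantiation omega1 :: zero
begin

definition zero_omega1 :: omega1
  where "0 = (LEAST \<gamma>::omega1. True)"

instance ..

end

lemma zero_le_omega1: "0 \<le> (\<gamma>::omega1)"
  unfolding zero_omega1_def by (rule Least_le) simp

lemma countable_below: "countable {..<\<gamma>::omega1}"
proof -
  let ?r = "cardSuc natLeq"
  have "|underS ?r (Rep_omega1 \<gamma>)| <o ?r"
    using card_of_underS[OF cardSuc_Card_order[OF natLeq_Card_order] Rep_omega1] .
  then have "|underS ?r (Rep_omega1 \<gamma>)| \<le>o natLeq"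
    using cardSuc_ordLess_ordLeq[OF natLeq_Card_order card_of_Card_order]
      cardSuc_ordLeq_ordLess[OF natLeq_Card_order card_of_Card_order] by blast
  then have "countable (underS ?r (Rep_omega1 \<gamma>))"
    using countable_card_of_nat card_of_nat ordIso_symmetric ordLeq_ordIso_trans by blast
  moreover have "Rep_omega1 ` {..<\<gamma>} \<subseteq> underS ?r (Rep_omega1 \<gamma>)"
    by (auto simp: underS_def less_omega1_def less_eq_omega1_def)
  ultimately have "countable (Rep_omega1 ` {..<\<gamma>})"
    by (rule countable_subset[rotated])
  then show ?thesis
    by (rule countable_image_inj_on) (auto simp: inj_on_def Rep_omega1_inject)
qed

lemma uncountable_omega1: "\<not> countable (UNIV :: omega1 set)"
proof
  assume "countable (UNIV :: omega1 set)"
  then have "countable (range Rep_omega1)" by simp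
  then show False
    using Field_cardSuc_natLeq_not_countable type_definition.Rep_range[OF type_definition_omega1]
    by simp
qed

unbundle no cardinal_syntax

text \<open>The range $\omega_1 \cup \{\mathbb{N}\}$ of the parameter $\alpha$.\<close>

datatype param = Ordinal omega1 | Naturals

fun below_param :: "omega1 \<Rightarrow> param \<Rightarrow> bool"
  where
    "below_param \<beta> (Ordinal \<alpha>) \<longleftrightarrow> \<beta> < \<alpha>"
  | "below_param \<beta> Naturals \<longleftrightarrow> True"

text \<open>
  Baire space is \<^typ>\<open>nat word\<close>, that is \<^typ>\<open>nat \<Rightarrow> nat\<close>, with the product topology of the
  library (\<^typ>\<open>nat\<close> being discrete). In a problem, \<^term>\<open>None\<close> means that the point is not an
  instance and \<^term>\<open>Some S\<close> that it is an instance with solution set \<^term>\<open>S\<close>, possibly empty.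
\<close>

type_synonym problem = "nat word \<rightharpoonup> nat word set"

definition initial_segment :: "nat list \<Rightarrow> nat word \<Rightarrow> bool"  (infix \<open>\<sqsubseteq>\<close> 50)
  where "\<sigma> \<sqsubseteq> x \<longleftrightarrow> prefix (length \<sigma>) x = \<sigma>"

definition cylinder :: "nat list \<Rightarrow> nat word set"
  where "cylinder \<sigma> = {x. \<sigma> \<sqsubseteq> x}"

text \<open>\<^term>\<open>P |` A\<close> is the restriction $P|_A$; the following is $P|[A \times B]$.\<close>

definition restrict_problem :: "problem \<Rightarrow> nat word set \<Rightarrow> nat word set \<Rightarrow> problem"
  where "restrict_problem P A B = (\<lambda>x. map_option (\<lambda>S. S \<inter> B) ((P |` A) x))"

definition continuous_problem :: "problem \<Rightarrow> bool"
  where "continuous_problem P \<longleftrightarrow>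
    (\<exists>\<Phi>. continuous_on (dom P) \<Phi> \<and> (\<forall>p \<in> dom P. \<Phi> p \<in> the (P p)))"

definition discontinuity :: "problem \<Rightarrow> nat word \<Rightarrow> bool"
  where "discontinuity P p \<longleftrightarrow>
    p \<in> dom P \<and> (\<forall>U. open U \<and> p \<in> U \<longrightarrow> \<not> continuous_problem (P |` U))"

text \<open>
  \<^term>\<open>rank_discontinuity P p \<alpha>\<close>: the point \<open>p\<close> is a rank-\<open>\<alpha>\<close> discontinuity of \<open>P\<close>. The clause
  \<open>\<forall>\<gamma>\<in>{..\<alpha>}. (\<dots>) = (\<gamma> = \<alpha>)\<close> says that \<open>\<alpha>\<close> is the least \<open>\<gamma>\<close> satisfying the condition; see
  \<open>rank_discontinuity_iff\<close> below.
\<close>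

function rank_discontinuity :: "problem \<Rightarrow> nat word \<Rightarrow> omega1 \<Rightarrow> bool"
  where
    "rank_discontinuity P p \<alpha> \<longleftrightarrow>
      discontinuity P p \<and>
      (if the (P p) = {} then \<alpha> = 0
       else 0 < \<alpha> \<and>
         (\<forall>\<gamma> \<in> {..\<alpha>}.
           (\<forall>q \<in> the (P p). \<exists>\<rho>. \<rho> \<sqsubseteq> q \<and>
             (\<forall>\<sigma>. \<sigma> \<sqsubseteq> p \<longrightarrow>
               (\<exists>p' \<in> dom P \<inter> cylinder \<sigma>. p' \<noteq> p \<and>
                 (\<exists>\<beta> \<in> {..<\<gamma>}.
                   rank_discontinuity (restrict_problem P (cylinder \<sigma>) (cylinder \<rho>)) p' \<beta>))))
           = (\<gamma> = \<alpha>)))"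
  by auto
termination
  by (relation "inv_image {(x, y). x < y} (\<lambda>(P, p, \<alpha>). \<alpha>)") (auto simp: wf)

declare rank_discontinuity.simps [simp del]

definition rank_condition :: "problem \<Rightarrow> nat word \<Rightarrow> omega1 \<Rightarrow> bool"
  where "rank_condition P p \<gamma> \<longleftrightarrow>
    (\<forall>q \<in> the (P p). \<exists>\<rho>. \<rho> \<sqsubseteq> q \<and>
      (\<forall>\<sigma>. \<sigma> \<sqsubseteq> p \<longrightarrow>
        (\<exists>p' \<in> dom P \<inter> cylinder \<sigma>. p' \<noteq> p \<and>
          (\<exists>\<beta> < \<gamma>. rank_discontinuity (restrict_problem P (cylinder \<sigma>) (cylinder \<rho>)) p' \<beta>))))"

lemma rank_discontinuity_iff:
  "rank_discontinuity P p \<alpha> \<longleftrightarrow>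
    discontinuity P p \<and>
    (if the (P p) = {} then \<alpha> = 0
     else 0 < \<alpha> \<and> rank_condition P p \<alpha> \<and> (\<forall>\<gamma> < \<alpha>. \<not> rank_condition P p \<gamma>))"
proof -
  have "rank_discontinuity P p \<alpha> \<longleftrightarrow>
    discontinuity P p \<and>
    (if the (P p) = {} then \<alpha> = 0
     else 0 < \<alpha> \<and> (\<forall>\<gamma> \<in> {..\<alpha>}. rank_condition P p \<gamma> = (\<gamma> = \<alpha>)))"
    by (subst rank_discontinuity.simps) (simp only: rank_condition_def Bex_def lessThan_iff)
  moreover have "(\<forall>\<gamma> \<in> {..\<alpha>}. rank_condition P p \<gamma> = (\<gamma> = \<alpha>)) \<longleftrightarrow>
      rank_condition P p \<alpha> \<and> (\<forall>\<gamma> < \<alpha>. \<not> rank_condition P p \<gamma>)"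
    by (metis atMost_iff order_le_less order_less_irrefl)
  ultimately show ?thesis by simp
qed

definition has_rank_discontinuity :: "problem \<Rightarrow> omega1 \<Rightarrow> bool"
  where "has_rank_discontinuity P \<alpha> \<longleftrightarrow> (\<exists>p. rank_discontinuity P p \<alpha>)"

text \<open>
  Total recursive functions (Kleene), minimisation being restricted to regular functions. The
  number is the arity: only values on argument lists of that length are relevant.
\<close>

inductive recursive :: "nat \<Rightarrow> (nat list \<Rightarrow> nat) \<Rightarrow> bool"
  where
    zero: "recursive n (\<lambda>xs. 0)"
  | succ: "recursive 1 (\<lambda>xs. Suc (xs ! 0))"
  | proj: "i < n \<Longrightarrow> recursive n (\<lambda>xs. xs ! i)"
  | comp: "recursive (length gs) f \<Longrightarrow> \<forall>g \<in> set gs. recursive n g \<Longrightarrow>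
      recursive n (\<lambda>xs. f (map (\<lambda>g. g xs) gs))"
  | prim: "recursive n f \<Longrightarrow> recursive (Suc (Suc n)) g \<Longrightarrow>
      recursive (Suc n) (\<lambda>xs. rec_nat (f (tl xs)) (\<lambda>k y. g (k # y # tl xs)) (hd xs))"
  | minim: "recursive (Suc n) f \<Longrightarrow> \<forall>xs. length xs = n \<longrightarrow> (\<exists>k. f (k # xs) = 0) \<Longrightarrow>
      recursive n (\<lambda>xs. LEAST k. f (k # xs) = 0)"

definition computable :: "(nat \<Rightarrow> nat) \<Rightarrow> bool"
  where "computable h \<longleftrightarrow> (\<exists>f. recursive 1 f \<and> (\<forall>x. h x = f [x]))"

text \<open>
  Finiteness of \<^term>\<open>{..<\<gamma>}\<close> means $\gamma < \omega$; in that case the ordinals below $\gamma$ are read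
  as natural numbers through \<^term>\<open>\<lambda>\<delta>. card {..<\<delta>}\<close>.
\<close>

definition enumerations :: "(omega1 \<Rightarrow> nat \<Rightarrow> omega1) \<Rightarrow> bool"
  where "enumerations w \<longleftrightarrow>
    (\<forall>\<gamma> > 0. range (w \<gamma>) = {..<\<gamma>} \<and>
      (finite {..<\<gamma>} \<longrightarrow> computable (\<lambda>i. card {..<w \<gamma> i})))"

text \<open>\<^term>\<open>descent w \<alpha>\<close> is the partial function $s_\alpha$.\<close>

fun descent :: "(omega1 \<Rightarrow> nat \<Rightarrow> omega1) \<Rightarrow> omega1 \<Rightarrow> nat list \<rightharpoonup> omega1 list"
  where
    "descent w \<gamma> [] = Some []"
  | "descent w \<gamma> (v # vs) =
      (if \<gamma> = 0 then None else map_option ((#) (w \<gamma> v)) (descent w (w \<gamma> v) vs))"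

text \<open>\<^term>\<open>None\<close> is the symbol \<open>#\<close>.\<close>

definition encode :: "nat option word \<Rightarrow> nat word"
  where "encode x = (\<lambda>i. case x i of None \<Rightarrow> 0 | Some a \<Rightarrow> Suc a)"

text \<open>$\theta_0 \# v_0 \theta_1 \# v_1 \cdots \theta_{k-1} \# v_{k-1} r$\<close>

definition interleave :: "nat list list \<Rightarrow> nat list \<Rightarrow> nat word \<Rightarrow> nat option word"
  where "interleave \<theta>s vs r =
    concat (map2 (\<lambda>\<theta> v. map Some \<theta> @ [None, Some v]) \<theta>s vs) \<frown> (Some \<circ> r)"

text \<open>
  Throughout, \<open>enc\<close> is the fixed bijection from \<^term>\<open>nsets UNIV n\<close> to the natural numbers, and a
  coloring is given as the sequence \<open>c\<close>, so that the color of a set \<open>S\<close> is \<^term>\<open>c (enc S)\<close>.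
\<close>

definition colors_of :: "nat \<Rightarrow> (nat set \<Rightarrow> nat) \<Rightarrow> nat word \<Rightarrow> nat set \<Rightarrow> nat set"
  where "colors_of n enc c A = (\<lambda>S. c (enc S)) ` nsets A n"

definition adds_new_color :: "nat word \<Rightarrow> nat \<Rightarrow> bool"
  where "adds_new_color c i \<longleftrightarrow> c i \<notin> c ` {..<i}"

definition name_of :: "(omega1 \<Rightarrow> nat \<Rightarrow> omega1) \<Rightarrow> omega1 \<Rightarrow> nat word \<Rightarrow> nat word \<Rightarrow> bool"
  where "name_of w \<alpha> c p \<longleftrightarrow>
    finite (range c) \<and>
    (let k = card (range c); ms = sorted_list_of_set {i. adds_new_color c i}
     in \<exists>\<theta>s vs r.
       length \<theta>s = k \<and> length vs = k \<and> vs \<in> dom (descent w \<alpha>) \<and>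
       c = concat \<theta>s \<frown> r \<and>
       (\<forall>i < k. concat (take (Suc i) \<theta>s) = prefix (Suc (ms ! i)) c) \<and>
       p = encode (interleave \<theta>s vs r))"

fun is_instance :: "(omega1 \<Rightarrow> nat \<Rightarrow> omega1) \<Rightarrow> param \<Rightarrow> nat word \<Rightarrow> nat word \<Rightarrow> bool"
  where
    "is_instance w (Ordinal \<alpha>) c p \<longleftrightarrow> name_of w \<alpha> c p"
  | "is_instance w Naturals c p \<longleftrightarrow> finite (range c) \<and> p = c"

text \<open>A finite 0-1 string is read as the finite set of the positions where it is 1.\<close>

definition string_set :: "nat list \<Rightarrow> nat set"
  where "string_set \<phi> = {i. i < length \<phi> \<and> \<phi> ! i = 1}"

definition is_solution ::
  "nat \<Rightarrow> (nat set \<Rightarrow> nat) \<Rightarrow> (omega1 \<Rightarrow> nat \<Rightarrow> omega1) \<Rightarrow> omega1 \<Rightarrow> nat word \<Rightarrow> nat word \<Rightarrow> bool"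
  where "is_solution n enc w \<beta> c y \<longleftrightarrow>
    (\<exists>k \<phi>s vs q A.
      length \<phi>s = k \<and> length vs = k \<and>
      y = encode (interleave \<phi>s vs q) \<and>
      concat \<phi>s \<frown> q = indicator A \<and> infinite A \<and>
      card (colors_of n enc c A) \<le> k \<and>
      vs \<in> dom (descent w \<beta>) \<and>
      (\<forall>i \<le> k. card (colors_of n enc c (string_set (concat (take i \<phi>s)))) \<le> i))"

text \<open>
  The coloring of an instance is uniquely determined (\<open>is_instance_unique\<close> below), so the
  existential quantifier in the solution set does not mix solutions to different colorings.
\<close>

definition RT ::
  "nat \<Rightarrow> (nat set \<Rightarrow> nat) \<Rightarrow> (omega1 \<Rightarrow> nat \<Rightarrow> omega1) \<Rightarrow> param \<Rightarrow> omega1 \<Rightarrow> problem"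
  where "RT n enc w \<alpha> \<beta> p =
    (if \<exists>c. is_instance w \<alpha> c p
     then Some {y. \<exists>c. is_instance w \<alpha> c p \<and> is_solution n enc w \<beta> c y}
     else None)"

lemma inj_encode: "encode x = encode y \<Longrightarrow> x = y"
proof (rule ext)
  fix i
  assume "encode x = encode y"
  then have "encode x i = encode y i" by simp
  then show "x i = y i" by (auto simp: encode_def split: option.splits)
qed

lemma interleave_Cons:
  "interleave (\<theta> # \<theta>s) (v # vs) r = map Some \<theta> \<frown> [None, Some v] \<frown> interleave \<theta>s vs r"
  by (simp add: interleave_def)

lemma separator_inject:
  fixes \<theta> \<theta>' :: "nat list"
  assumes "map Some \<theta> \<frown> [None, Some v] \<frown> x = map Some \<theta>' \<frown> [None, Some v'] \<frown> x'"
  shows "\<theta> = \<theta>' \<and> v = v' \<and> x = x'"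
proof -
  let ?X = "map Some \<theta> \<frown> [None, Some v] \<frown> x" and ?Y = "map Some \<theta>' \<frown> [None, Some v'] \<frown> x'"
  have first: "(LEAST i. (map Some \<theta> \<frown> [None, Some v] \<frown> x) i = None) = length \<theta>"
    for \<theta> :: "nat list" and v and x :: "nat option word"
    by (rule Least_equality) (auto simp: conc_def simp flip: not_less)
  have len: "length \<theta> = length \<theta>'"
    using first[of \<theta> v x] first[of \<theta>' v' x'] assms by simp
  have "\<theta> = \<theta>'"
  proof (rule nth_equalityI[OF len])
    fix i
    assume "i < length \<theta>"
    with fun_cong[OF assms, of i] len show "\<theta> ! i = \<theta>' ! i" by (simp add: conc_def)
  qed
  moreover have "v = v'"
    using fun_cong[OF assms, of "Suc (length \<theta>)"] len by (simp add: conc_def)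
  moreover have "x i = x' i" for i
    using fun_cong[OF assms, of "length \<theta> + 2 + i"] len by (simp add: conc_def)
  ultimately show ?thesis by auto
qed

lemma interleave_inject:
  assumes "interleave \<theta>s vs r = interleave \<theta>s' vs' r'"
    and "length vs = length \<theta>s" "length vs' = length \<theta>s'"
  shows "\<theta>s = \<theta>s' \<and> vs = vs' \<and> r = r'"
  using assms
proof (induction \<theta>s arbitrary: vs \<theta>s' vs')
  have nil: "interleave [] [] r \<noteq> interleave (\<theta> # \<theta>s) (v # vs) r''" for \<theta> \<theta>s v vs r r''
  proof
    assume "interleave [] [] r = interleave (\<theta> # \<theta>s) (v # vs) r''"
    from fun_cong[OF this, of "length \<theta>"] show False
      by (simp add: interleave_def conc_def nth_append)
  qed
  {
    case Nil
    note Nil_prems = Nil.prems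
    show ?case
    proof (cases \<theta>s')
      case Nil
      with Nil_prems show ?thesis
        by (simp add: interleave_def fun_eq_iff)
    next
      case (Cons \<theta>' \<theta>s'')
      with Nil_prems obtain v' us' where "vs' = v' # us'" by (cases vs') auto
      with Nil_prems Cons nil show ?thesis by simp
    qed
  next
    case (Cons \<theta> \<theta>s)
    from Cons.prems obtain v us where vs: "vs = v # us" "length us = length \<theta>s"
      by (cases vs) auto
    show ?case
    proof (cases \<theta>s')
      case Nil
      with Cons.prems vs nil show ?thesis by (metis length_0_conv)
    next
      case (Cons \<theta>' \<theta>s'')
      with Cons.prems obtain v' us' where vs': "vs' = v' # us'" "length us' = length \<theta>s''"
        by (cases vs') auto
      from Cons.prems(1) have "map Some \<theta> \<frown> [None, Some v] \<frown> interleave \<theta>s us r =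
          map Some \<theta>' \<frown> [None, Some v'] \<frown> interleave \<theta>s'' us' r'"
        unfolding vs(1) vs'(1) Cons interleave_Cons .
      from separator_inject[OF this] Cons.IH[of us \<theta>s'' us'] vs vs' Cons show ?thesis by auto
    qed
  }
qed

lemma is_instance_unique: "is_instance w \<alpha> c p \<Longrightarrow> is_instance w \<alpha> c' p \<Longrightarrow> c = c'"
proof (cases \<alpha>)
  case (Ordinal \<gamma>)
  assume "is_instance w \<alpha> c p" "is_instance w \<alpha> c' p"
  then obtain \<theta>s vs r \<theta>s' vs' r' where
    "length vs = length \<theta>s" "c = concat \<theta>s \<frown> r" "p = encode (interleave \<theta>s vs r)"
    "length vs' = length \<theta>s'" "c' = concat \<theta>s' \<frown> r'" "p = encode (interleave \<theta>s' vs' r')"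
    unfolding Ordinal is_instance.simps name_of_def Let_def by metis
  then show ?thesis
    using inj_encode interleave_inject by metis
qed simp

end

theory Submission
  imports Defs
begin

text \<open>
  The rank of a discontinuity \<open>p\<close> measures a game between a solver, who produces a solution
  to the instance \<open>p\<close>, and an opponent, who waits for a finite part of that solution and then changes
  the instance beyond a finite part of it, each change being paid for with a smaller ordinal. The
  predicate \<open>obstructed P B \<gamma> p\<close> says that the opponent wins with initial ordinal \<open>\<gamma>\<close> if solutions
  are confined to \<open>B\<close>. By \<open>rank_discontinuity_iff_least_obstructed\<close>, the rank of \<open>p\<close> is the least
  such \<open>\<gamma>\<close> for unconfined solutions. So it has to be shown that the opponent wins with \<open>\<beta>\<close> from some
  instance, and with no smaller ordinal from any instance.

  The solver holds an ordinal counter that starts at \<open>\<beta>\<close>: every further color in her infinite set requires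
  an announcement that lowers the counter.

  The opponent wins with \<open>\<beta>\<close> by imitation (\<open>obstructed_RT\<close>). He starts with a monochromatic coloring
  whose only color is announced with \<open>\<beta> < \<alpha>\<close>. Since his coloring is eventually constant, an infinite
  set has to use the last color, and the solver must make one announcement for it. He repeats the
  announced ordinal with a fresh color and uses only this color from then on. Both counters go down
  together, and the solver's is exhausted when she needs it.

  The solver wins against every \<open>\<gamma> < \<beta>\<close> (\<open>not_obstructed_RT\<close>) by announcing the opponent's current
  ordinal \<open>\<gamma>\<close> and filling her set with one infinite color class. After the opponent's change he is
  left with a smaller ordinal \<open>\<delta>\<close>, which she can announce in turn. Each round costs her one announcement
  and adds at most one color.

  That these moves are available is a matter of coding: a finite segment of a name determines a
  finite segment of its coloring (\<open>instance_determines_prefix\<close>), and a name may be continued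
  by a fresh color after any finite segment (\<open>extend_instance\<close>).
\<close>

section \<open>Cylinders\<close>

lemma cylinder_prefix_iff: "y \<in> cylinder (prefix n x) \<longleftrightarrow> prefix n y = prefix n x"
  by (auto simp: cylinder_def initial_segment_def)

lemma initial_segment_iff_prefix: "\<sigma> \<sqsubseteq> x \<longleftrightarrow> (\<exists>n. \<sigma> = prefix n x)"
proof
  assume "\<sigma> \<sqsubseteq> x"
  then have "\<sigma> = prefix (length \<sigma>) x" by (simp add: initial_segment_def)
  then show "\<exists>n. \<sigma> = prefix n x" ..
qed (auto simp: initial_segment_def)

lemma prefix_eq_iff: "prefix n x = prefix n y \<longleftrightarrow> (\<forall>i<n. x i = y i)"
  by (auto simp: list_eq_iff_nth_eq)

lemma prefix_cong_le: "prefix n x = prefix n y \<Longrightarrow> m \<le> n \<Longrightarrow> prefix m x = prefix m y"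
  by (simp add: prefix_eq_iff)

lemma cylinder_prefix_antimono: "m \<le> n \<Longrightarrow> cylinder (prefix n x) \<subseteq> cylinder (prefix m x)"
  by (auto simp: cylinder_prefix_iff prefix_eq_iff)

lemma open_cylinder: "open (cylinder \<sigma>)"
proof -
  let ?X = "\<lambda>i. if i < length \<sigma> then {\<sigma> ! i} else UNIV"
  have "x \<in> cylinder \<sigma> \<longleftrightarrow> (\<forall>i < length \<sigma>. x i = \<sigma> ! i)" for x
    unfolding cylinder_def initial_segment_def mem_Collect_eq list_eq_iff_nth_eq by simp
  moreover have "x \<in> Pi\<^sub>E UNIV ?X \<longleftrightarrow> (\<forall>i < length \<sigma>. x i = \<sigma> ! i)" for x
    by (simp add: PiE_iff)
  ultimately have eq: "cylinder \<sigma> = Pi\<^sub>E UNIV ?X" by blast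
  have "{i. ?X i \<noteq> UNIV} \<subseteq> {..<length \<sigma>}" by auto
  then have "finite {i. ?X i \<noteq> UNIV}" by (rule finite_subset) simp
  then show ?thesis unfolding eq by (intro open_PiE) (simp_all add: open_discrete)
qed

lemma open_contains_cylinder:
  assumes "open U" and "x \<in> U"
  obtains n where "cylinder (prefix n x) \<subseteq> U"
proof -
  have "openin (product_topology (\<lambda>i. euclidean) UNIV) U"
    using assms(1) by (simp add: open_fun_def)
  then obtain X where X: "x \<in> Pi\<^sub>E UNIV X" "finite {i. X i \<noteq> (UNIV :: nat set)}" "Pi\<^sub>E UNIV X \<subseteq> U"
    using product_topology_open_contains_basis[of "\<lambda>i. euclidean" UNIV U x] assms(2) by auto
  define n where "n = Suc (Max (insert 0 {i. X i \<noteq> UNIV}))"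
  have "i < n" if "X i \<noteq> UNIV" for i
    using X(2) that by (auto simp: n_def less_Suc_eq_le intro!: Max_ge)
  then have "y i \<in> X i" if "y \<in> cylinder (prefix n x)" for y i
    using X(1) that unfolding cylinder_prefix_iff prefix_eq_iff PiE_iff by (metis UNIV_I)
  then have "cylinder (prefix n x) \<subseteq> Pi\<^sub>E UNIV X"
    by (simp add: subset_iff PiE_iff)
  then show ?thesis by (rule that[OF subset_trans[OF _ X(3)]])
qed

section \<open>Rank as a least ordinal\<close>

text \<open>
  The defining condition of a rank, stripped of three things: the minimality of the ordinal, the
  requirement that the point be a discontinuity, and the restriction of the instances to a
  neighborhood. What remains is monotone in \<open>\<gamma>\<close> and antitone in the set \<open>B\<close> of admissible
  solutions, so it can be handled by plain induction. It describes a game: the solver plays a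
  solution \<open>q\<close>, the opponent commits her to an initial segment \<open>\<rho>\<close> of it and changes the instance
  beyond any prescribed initial segment \<open>\<sigma>\<close>, paying with a decrease of the ordinal. The opponent
  wins when no admissible solution is left.
\<close>

inductive obstructed :: "problem \<Rightarrow> nat word set \<Rightarrow> omega1 \<Rightarrow> nat word \<Rightarrow> bool" for P
  where obstructedI:
    "(\<And>q. q \<in> the (P p) \<inter> B \<Longrightarrow> \<exists>\<rho>. \<rho> \<sqsubseteq> q \<and>
      (\<forall>\<sigma>. \<sigma> \<sqsubseteq> p \<longrightarrow>
        (\<exists>p' \<in> dom P \<inter> cylinder \<sigma>. p' \<noteq> p \<and> (\<exists>\<delta> < \<gamma>. obstructed P (B \<inter> cylinder \<rho>) \<delta> p'))))
    \<Longrightarrow> obstructed P B \<gamma> p"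

lemma obstructed_iff:
  "obstructed P B \<gamma> p \<longleftrightarrow> (\<forall>q \<in> the (P p) \<inter> B. \<exists>\<rho>. \<rho> \<sqsubseteq> q \<and>
      (\<forall>\<sigma>. \<sigma> \<sqsubseteq> p \<longrightarrow>
        (\<exists>p' \<in> dom P \<inter> cylinder \<sigma>. p' \<noteq> p \<and> (\<exists>\<delta> < \<gamma>. obstructed P (B \<inter> cylinder \<rho>) \<delta> p'))))"
    (is "_ \<longleftrightarrow> ?R")
proof
  assume "obstructed P B \<gamma> p"
  then show ?R by cases (rule ballI)
next
  assume ?R
  show "obstructed P B \<gamma> p"
    by (rule obstructed.intros, rule bspec[OF \<open>?R\<close>])
qed

lemma obstructed_antimono: "obstructed P B \<gamma> p \<Longrightarrow> B' \<subseteq> B \<Longrightarrow> obstructed P B' \<gamma> p"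
proof (induction arbitrary: B' rule: obstructed.induct)
  case (obstructedI p B \<gamma>)
  have sub: "B' \<inter> cylinder \<rho> \<subseteq> B \<inter> cylinder \<rho>" for \<rho>
    using obstructedI.prems by blast
  show ?case
  proof (rule obstructed.intros)
    fix q assume "q \<in> the (P p) \<inter> B'"
    then have "q \<in> the (P p) \<inter> B" using obstructedI.prems by blast
    from obstructedI.IH[OF this] show "\<exists>\<rho>. \<rho> \<sqsubseteq> q \<and> (\<forall>\<sigma>. \<sigma> \<sqsubseteq> p \<longrightarrow>
        (\<exists>p' \<in> dom P \<inter> cylinder \<sigma>. p' \<noteq> p \<and> (\<exists>\<delta> < \<gamma>. obstructed P (B' \<inter> cylinder \<rho>) \<delta> p')))"
      using sub by meson
  qed
qed

lemma not_less_zero_omega1: "\<not> \<gamma> < (0 :: omega1)"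
  by (simp add: not_less zero_le_omega1)

text \<open>
  With this, the separate clause for rank 0 in the definition of rank becomes an instance of the
  general one.
\<close>

lemma obstructed_zero_iff: "obstructed P B 0 p \<longleftrightarrow> the (P p) \<inter> B = {}"
proof
  show "obstructed P B 0 p" if "the (P p) \<inter> B = {}"
    by (rule obstructed.intros) (use that in blast)
  show "the (P p) \<inter> B = {}" if obs: "obstructed P B 0 p"
  proof (rule equals0I)
    fix q assume "q \<in> the (P p) \<inter> B"
    moreover have "[] \<sqsubseteq> p" by (simp add: initial_segment_def)
    ultimately obtain \<delta> :: omega1 where "\<delta> < 0"
      using obs unfolding obstructed_iff[of P B 0] by blast
    then show False by (simp add: not_less_zero_omega1)
  qed
qed

lemma restrict_restrict_problem:
  "restrict_problem (restrict_problem P A B) A' B' = restrict_problem P (A \<inter> A') (B \<inter> B')"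
  by (rule ext) (simp add: restrict_problem_def restrict_map_def option.map_comp o_def Int_assoc)

lemma dom_restrict_problem: "dom (restrict_problem P A B) = dom P \<inter> A"
  by (auto simp: restrict_problem_def restrict_map_def split: if_splits)

lemma the_restrict_problem: "p \<in> dom P \<inter> A \<Longrightarrow> the (restrict_problem P A B p) = the (P p) \<inter> B"
  by (auto simp: restrict_problem_def restrict_map_def)

text \<open>
  A continuous realizer \<open>\<Phi>\<close> near \<open>p\<close> sends a whole cylinder around \<open>p\<close> into the cylinder of the
  segment \<open>\<rho>\<close> of \<open>\<Phi> p\<close> supplied by the condition. Hence it also realizes the restricted problem,
  which the condition says to be discontinuous at some \<open>p'\<close>.
\<close>

lemma rank_condition_imp_discontinuity:
  assumes p: "p \<in> dom P" and cond: "rank_condition P p \<gamma>"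
  shows "discontinuity P p"
  unfolding discontinuity_def
proof (intro conjI p allI impI notI)
  fix U assume U: "open U \<and> p \<in> U" and "continuous_problem (P |` U)"
  then obtain \<Phi> where \<Phi>: "continuous_on (dom P \<inter> U) \<Phi>" "\<And>x. x \<in> dom P \<inter> U \<Longrightarrow> \<Phi> x \<in> the (P x)"
    unfolding continuous_problem_def by auto
  have pU: "p \<in> dom P \<inter> U" using p U by blast
  then obtain \<rho> where \<rho>: "\<rho> \<sqsubseteq> \<Phi> p"
    and out: "\<And>\<sigma>. \<sigma> \<sqsubseteq> p \<Longrightarrow> \<exists>p' \<in> dom P \<inter> cylinder \<sigma>. p' \<noteq> p \<and>
       (\<exists>\<beta> < \<gamma>. rank_discontinuity (restrict_problem P (cylinder \<sigma>) (cylinder \<rho>)) p' \<beta>)"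
    using cond \<Phi>(2) unfolding rank_condition_def by meson
  from \<rho> have "\<Phi> p \<in> cylinder \<rho>" by (simp add: cylinder_def)
  then obtain V where V: "open V" "p \<in> V" "\<And>x. x \<in> dom P \<inter> U \<Longrightarrow> x \<in> V \<Longrightarrow> \<Phi> x \<in> cylinder \<rho>"
    using \<Phi>(1)[unfolded continuous_on_topological] pU open_cylinder by metis
  have "open (U \<inter> V)" "p \<in> U \<inter> V" using U V by auto
  then obtain n where n: "cylinder (prefix n p) \<subseteq> U \<inter> V"
    by (rule open_contains_cylinder)
  define R where "R = restrict_problem P (cylinder (prefix n p)) (cylinder \<rho>)"
  have domR: "dom R = dom P \<inter> cylinder (prefix n p)"
    by (simp add: R_def dom_restrict_problem)
  have "continuous_problem (R |` UNIV)"
    unfolding continuous_problem_def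
  proof (intro exI[of _ \<Phi>] conjI ballI)
    show "continuous_on (dom (R |` UNIV)) \<Phi>"
      using \<Phi>(1) by (rule continuous_on_subset) (use n domR in auto)
    fix x assume "x \<in> dom (R |` UNIV)"
    then have x: "x \<in> dom P \<inter> cylinder (prefix n p)" using domR by simp
    then have "\<Phi> x \<in> the (P x) \<inter> cylinder \<rho>" using n \<Phi>(2) V(3) by blast
    with x show "\<Phi> x \<in> the ((R |` UNIV) x)"
      by (simp add: R_def the_restrict_problem)
  qed
  moreover obtain p' where "discontinuity R p'"
    using out[of "prefix n p"] unfolding R_def initial_segment_iff_prefix rank_discontinuity_iff
    by blast
  ultimately show False unfolding discontinuity_def by auto
qed

lemma empty_imp_discontinuity: "p \<in> dom P \<Longrightarrow> the (P p) = {} \<Longrightarrow> discontinuity P p"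
proof -
  assume p: "p \<in> dom P" "the (P p) = {}"
  have "\<not> continuous_problem (P |` U)" if "p \<in> U" for U
  proof
    assume "continuous_problem (P |` U)"
    then obtain \<Phi> where "\<forall>x \<in> dom (P |` U). \<Phi> x \<in> the ((P |` U) x)"
      unfolding continuous_problem_def by blast
    from bspec[OF this, of p] p that show False by simp
  qed
  with p show ?thesis unfolding discontinuity_def by blast
qed

text \<open>
  Restricting a restriction intersects the two sets of instances and the two sets of solutions, so
  the induction on the rank has to treat all \<open>A\<close> and \<open>B\<close> at once. The set \<open>A\<close> leaves no trace in
  \<^const>\<open>obstructed\<close> because the condition asks for points \<open>p'\<close> arbitrarily close to \<open>p\<close>, and an open
  \<open>A\<close> contains all of these from some point on.
\<close>

lemma rank_discontinuity_iff_obstructed: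
  assumes "open A"
  shows "rank_discontinuity (restrict_problem P A B) p \<gamma> \<longleftrightarrow>
    p \<in> dom P \<inter> A \<and> obstructed P B \<gamma> p \<and> (\<forall>\<delta> < \<gamma>. \<not> obstructed P B \<delta> p)"
  using assms
proof (induction \<gamma> arbitrary: A B p rule: less_induct)
  case (less \<gamma>)
  let ?R = "restrict_problem P A B"
  \<comment> \<open>Below a bound, some ordinal works iff a least one does; so minimality may be dropped.\<close>
  have least: "(\<exists>\<delta> < \<epsilon>. obstructed P B' \<delta> p' \<and> (\<forall>\<delta>' < \<delta>. \<not> obstructed P B' \<delta>' p'))
      \<longleftrightarrow> (\<exists>\<delta> < \<epsilon>. obstructed P B' \<delta> p')" for B' p' and \<epsilon> :: omega1
  proof
    assume "\<exists>\<delta> < \<epsilon>. obstructed P B' \<delta> p'"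
    then obtain \<delta> where \<delta>: "\<delta> < \<epsilon>" "obstructed P B' \<delta> p'" by blast
    then obtain \<delta>' where \<delta>': "obstructed P B' \<delta>' p'" "\<forall>\<eta> < \<delta>'. \<not> obstructed P B' \<eta> p'"
      using exists_least_iff[of "\<lambda>\<delta>. obstructed P B' \<delta> p'"] by blast
    with \<delta> have "\<delta>' \<le> \<delta>" by (meson not_less)
    with \<delta>(1) have "\<delta>' < \<epsilon>" by (rule order_le_less_trans[rotated])
    with \<delta>' show "\<exists>\<delta> < \<epsilon>. obstructed P B' \<delta> p' \<and> (\<forall>\<delta>' < \<delta>. \<not> obstructed P B' \<delta>' p')"
      by blast
  qed blast
  have cond: "rank_condition ?R p \<epsilon> \<longleftrightarrow> obstructed P B \<epsilon> p"
    if p: "p \<in> dom P \<inter> A" and "\<epsilon> \<le> \<gamma>" for \<epsilon>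
  proof -
    have inner: "(\<exists>p' \<in> dom ?R \<inter> cylinder \<sigma>. p' \<noteq> p \<and> (\<exists>\<delta> < \<epsilon>.
          rank_discontinuity (restrict_problem ?R (cylinder \<sigma>) (cylinder \<rho>)) p' \<delta>)) \<longleftrightarrow>
        (\<exists>p' \<in> dom P \<inter> (A \<inter> cylinder \<sigma>). p' \<noteq> p \<and> (\<exists>\<delta> < \<epsilon>. obstructed P (B \<inter> cylinder \<rho>) \<delta> p'))"
      for \<sigma> \<rho>
    proof -
      have "rank_discontinuity (restrict_problem ?R (cylinder \<sigma>) (cylinder \<rho>)) p' \<delta> \<longleftrightarrow>
          p' \<in> dom P \<inter> (A \<inter> cylinder \<sigma>) \<and> obstructed P (B \<inter> cylinder \<rho>) \<delta> p' \<and>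
          (\<forall>\<eta> < \<delta>. \<not> obstructed P (B \<inter> cylinder \<rho>) \<eta> p')" if "\<delta> < \<epsilon>" for p' \<delta>
        unfolding restrict_restrict_problem
        using that \<open>\<epsilon> \<le> \<gamma>\<close> less.prems open_cylinder by (intro less.IH open_Int) auto
      then have "(\<exists>\<delta> < \<epsilon>. rank_discontinuity (restrict_problem ?R (cylinder \<sigma>) (cylinder \<rho>)) p' \<delta>)
          \<longleftrightarrow> p' \<in> dom P \<inter> (A \<inter> cylinder \<sigma>) \<and> (\<exists>\<delta> < \<epsilon>. obstructed P (B \<inter> cylinder \<rho>) \<delta> p')" for p'
        unfolding least[symmetric] by blast
      then show ?thesis by (auto simp: dom_restrict_problem)
    qed
    obtain m where m: "cylinder (prefix m p) \<subseteq> A"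
      using open_contains_cylinder[OF less.prems] p by blast
    \<comment> \<open>Lengthening \<open>\<sigma>\<close> until its cylinder lies inside \<open>A\<close> absorbs the restriction to \<open>A\<close>.\<close>
    have local: "(\<forall>\<sigma>. \<sigma> \<sqsubseteq> p \<longrightarrow> (\<exists>p' \<in> dom P \<inter> (A \<inter> cylinder \<sigma>). Q p')) \<longleftrightarrow>
        (\<forall>\<sigma>. \<sigma> \<sqsubseteq> p \<longrightarrow> (\<exists>p' \<in> dom P \<inter> cylinder \<sigma>. Q p'))" for Q
    proof
      assume *: "\<forall>\<sigma>. \<sigma> \<sqsubseteq> p \<longrightarrow> (\<exists>p' \<in> dom P \<inter> cylinder \<sigma>. Q p')"
      show "\<forall>\<sigma>. \<sigma> \<sqsubseteq> p \<longrightarrow> (\<exists>p' \<in> dom P \<inter> (A \<inter> cylinder \<sigma>). Q p')"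
      proof (intro allI impI)
        fix \<sigma> assume "\<sigma> \<sqsubseteq> p"
        then obtain n where \<sigma>: "\<sigma> = prefix n p" by (auto simp: initial_segment_iff_prefix)
        have "prefix (max m n) p \<sqsubseteq> p" by (auto simp: initial_segment_iff_prefix)
        then obtain p' where "p' \<in> dom P \<inter> cylinder (prefix (max m n) p)" "Q p'"
          using * by blast
        moreover have "cylinder (prefix (max m n) p) \<subseteq> A \<inter> cylinder \<sigma>"
          using m \<sigma> cylinder_prefix_antimono[of m "max m n" p]
            cylinder_prefix_antimono[of n "max m n" p] by auto
        ultimately show "\<exists>p' \<in> dom P \<inter> (A \<inter> cylinder \<sigma>). Q p'" by blast
      qed
    qed blast
    show ?thesis
      unfolding rank_condition_def inner local the_restrict_problem[OF p]
      by (rule obstructed_iff[symmetric])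
  qed
  show ?case
  proof (cases "p \<in> dom P \<inter> A")
    case False
    then show ?thesis
      by (auto simp: rank_discontinuity_iff discontinuity_def dom_restrict_problem)
  next
    case True
    have disc: "discontinuity ?R p" if "obstructed P B \<gamma> p"
      using rank_condition_imp_discontinuity[of p ?R \<gamma>] cond[OF True order_refl] that True
      by (simp add: dom_restrict_problem)
    show ?thesis
    proof (cases "the (P p) \<inter> B = {}")
      case empty: True
      then have "obstructed P B 0 p" by (simp add: obstructed_zero_iff)
      moreover have "discontinuity ?R p"
        using empty True
        by (intro empty_imp_discontinuity) (simp_all add: dom_restrict_problem the_restrict_problem)
      moreover have "(\<forall>\<delta> < \<gamma>. \<not> obstructed P B \<delta> p) \<longleftrightarrow> \<gamma> = 0"
        if "obstructed P B 0 p" using that by (metis not_less_zero_omega1 linorder_neqE)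
      ultimately show ?thesis
        using True empty
        by (auto simp: rank_discontinuity_iff the_restrict_problem[OF True])
    next
      case nonempty: False
      then have "\<not> obstructed P B 0 p" by (simp add: obstructed_zero_iff)
      then have "obstructed P B \<gamma> p \<Longrightarrow> 0 < \<gamma>"
        by (metis not_less_zero_omega1 linorder_neqE)
      then show ?thesis
        using True nonempty disc cond[OF True]
        by (auto simp: rank_discontinuity_iff the_restrict_problem[OF True])
    qed
  qed
qed

lemma restrict_problem_UNIV: "restrict_problem P UNIV UNIV = P"
  by (rule ext) (simp add: restrict_problem_def option.map_ident)

lemma rank_discontinuity_iff_least_obstructed:
  "rank_discontinuity P p \<gamma> \<longleftrightarrow>
    p \<in> dom P \<and> obstructed P UNIV \<gamma> p \<and> (\<forall>\<delta> < \<gamma>. \<not> obstructed P UNIV \<delta> p)"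
  using rank_discontinuity_iff_obstructed[of UNIV P UNIV p \<gamma>] by (simp add: restrict_problem_UNIV)

section \<open>Parsing finite initial segments\<close>

text \<open>
  Instances over ordinals and solutions share one format; \<open>code \<theta>s vs\<close> is the finite part of such
  a sequence, up to and including the last announcement, in the encoding with \<open>#\<close> as 0.
\<close>

definition code :: "nat list list \<Rightarrow> nat list \<Rightarrow> nat list"
  where "code \<theta>s vs = concat (map2 (\<lambda>\<theta> v. map Suc \<theta> @ [0, Suc v]) \<theta>s vs)"

lemma encode_interleave: "encode (interleave \<theta>s vs r) = code \<theta>s vs \<frown> (Suc \<circ> r)"
proof -
  let ?d = "\<lambda>x. case x of None \<Rightarrow> 0 | Some a \<Rightarrow> Suc a"
  have "encode x = ?d \<circ> x" for x by (simp add: encode_def fun_eq_iff)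
  moreover have "map ?d (concat (map2 (\<lambda>\<theta> v. map Some \<theta> @ [None, Some v]) \<theta>s vs)) = code \<theta>s vs"
    unfolding code_def by (induction \<theta>s vs rule: list_induct2') simp_all
  moreover have "?d \<circ> (Some \<circ> r) = Suc \<circ> r" by (simp add: fun_eq_iff)
  ultimately show ?thesis by (simp add: interleave_def)
qed

lemma code_snoc:
  "length vs = length \<theta>s \<Longrightarrow> code (\<theta>s @ [\<theta>]) (vs @ [v]) = code \<theta>s vs @ map Suc \<theta> @ [0, Suc v]"
  by (simp add: code_def)

text \<open>
  The content of a finite string and the numbers announced in it. Both functions make sense for
  strings that break off anywhere: a final 0 is a \<open>#\<close> whose number is still missing. A string
  therefore contributes only what every infinite sequence extending it must agree with.
\<close>

fun letters :: "nat list \<Rightarrow> nat list" where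
  "letters [] = []"
| "letters (Suc a # xs) = a # letters xs"
| "letters [0] = []"
| "letters (0 # v # xs) = letters xs"

fun announcements :: "nat list \<Rightarrow> nat list" where
  "announcements [] = []"
| "announcements (Suc a # xs) = announcements xs"
| "announcements [0] = []"
| "announcements (0 # v # xs) = (v - 1) # announcements xs"

lemma letters_map_Suc_append: "letters (map Suc xs @ ys) = xs @ letters ys"
  by (induction xs) simp_all

lemma announcements_map_Suc_append: "announcements (map Suc xs @ ys) = announcements ys"
  by (induction xs) simp_all

lemma letters_code_append:
  "length vs = length \<theta>s \<Longrightarrow> letters (code \<theta>s vs @ ys) = concat \<theta>s @ letters ys"
  by (induction vs \<theta>s rule: list_induct2) (simp_all add: code_def letters_map_Suc_append)

lemma announcements_code_append:
  "length vs = length \<theta>s \<Longrightarrow> announcements (code \<theta>s vs @ ys) = vs @ announcements ys"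
  by (induction vs \<theta>s rule: list_induct2) (simp_all add: code_def announcements_map_Suc_append)

text \<open>
  Reading is monotone. So anything read from an initial segment of a code can be compared with what
  is read from a segment long enough to contain all announcements.
\<close>

lemma letters_append: "\<exists>zs. letters (xs @ ys) = letters xs @ zs"
  by (induction xs rule: letters.induct) auto

lemma announcements_append: "\<exists>zs. announcements (xs @ ys) = announcements xs @ zs"
  by (induction xs rule: announcements.induct) auto

lemma prefix_add_ex: "\<exists>zs. prefix (n + m) x = prefix n x @ zs"
  by (simp add: subsequence_append)

lemma prefix_code:
  assumes "length (code \<theta>s vs) \<le> n"
  shows "prefix n (code \<theta>s vs \<frown> (Suc \<circ> r)) =
    code \<theta>s vs @ map Suc (prefix (n - length (code \<theta>s vs)) r)"
proof -
  have "prefix m (Suc \<circ> r) = map Suc (prefix m r)" for m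
    by (simp add: subsequence_def)
  then show ?thesis using assms by simp
qed

lemma letters_prefix_eventually:
  assumes "length vs = length \<theta>s" and "length (code \<theta>s vs) \<le> n"
  shows "letters (prefix n (code \<theta>s vs \<frown> (Suc \<circ> r))) =
    concat \<theta>s @ prefix (n - length (code \<theta>s vs)) r"
  using letters_map_Suc_append[of _ "[]"]
  by (simp add: prefix_code[OF assms(2)] letters_code_append[OF assms(1)])

lemma announcements_prefix_eventually:
  assumes "length vs = length \<theta>s" and "length (code \<theta>s vs) \<le> n"
  shows "announcements (prefix n (code \<theta>s vs \<frown> (Suc \<circ> r))) = vs"
  using announcements_map_Suc_append[of _ "[]"]
  by (simp add: prefix_code[OF assms(2)] announcements_code_append[OF assms(1)])

lemma letters_prefix:
  assumes "length vs = length \<theta>s"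
  obtains zs x where "concat \<theta>s \<frown> r = (letters (prefix n (code \<theta>s vs \<frown> (Suc \<circ> r))) @ zs) \<frown> x"
proof -
  let ?y = "code \<theta>s vs \<frown> (Suc \<circ> r)" and ?l = "length (code \<theta>s vs)"
  obtain ys where "prefix (n + ?l) ?y = prefix n ?y @ ys"
    using prefix_add_ex by blast
  then obtain zs where "letters (prefix (n + ?l) ?y) = letters (prefix n ?y) @ zs"
    using letters_append by metis
  then have "concat \<theta>s @ prefix n r = letters (prefix n ?y) @ zs"
    using letters_prefix_eventually[OF assms, of "n + ?l" r] by simp
  moreover have "concat \<theta>s \<frown> r = (concat \<theta>s @ prefix n r) \<frown> suffix n r"
    by (metis conc_conc prefix_suffix)
  ultimately show ?thesis using that by metis
qed

lemma announcements_prefix: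
  assumes "length vs = length \<theta>s"
  obtains us where "vs = announcements (prefix n (code \<theta>s vs \<frown> (Suc \<circ> r))) @ us"
proof -
  let ?y = "code \<theta>s vs \<frown> (Suc \<circ> r)" and ?l = "length (code \<theta>s vs)"
  obtain ys where "prefix (n + ?l) ?y = prefix n ?y @ ys"
    using prefix_add_ex by blast
  then obtain us where "announcements (prefix (n + ?l) ?y) = announcements (prefix n ?y) @ us"
    using announcements_append by metis
  moreover have "announcements (prefix (n + ?l) ?y) = vs"
    by (rule announcements_prefix_eventually[OF assms]) simp
  ultimately show ?thesis using that by metis
qed

section \<open>Descending sequences of ordinals\<close>

text \<open>
  The last ordinal of the descending sequence is \<^term>\<open>foldl w \<gamma> vs\<close>, which is \<open>\<gamma>\<close> itself if nothing
  has been announced yet. It is the budget that remains: one more announcement is possible iff it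
  is nonzero.
\<close>

lemma descent_snoc_iff:
  "vs @ [v] \<in> dom (descent w \<gamma>) \<longleftrightarrow> vs \<in> dom (descent w \<gamma>) \<and> foldl w \<gamma> vs \<noteq> 0"
  by (induction vs arbitrary: \<gamma>) (auto simp: domIff)

lemma descent_append_dom: "vs @ us \<in> dom (descent w \<gamma>) \<Longrightarrow> vs \<in> dom (descent w \<gamma>)"
  by (induction us rule: rev_induct) (auto simp flip: append_assoc simp: descent_snoc_iff)

lemma enumerations_range: "enumerations w \<Longrightarrow> \<gamma> \<noteq> 0 \<Longrightarrow> range (w \<gamma>) = {..<\<gamma>}"
  unfolding enumerations_def using zero_le_omega1 by (metis order_le_less)

lemma enumerations_less: "enumerations w \<Longrightarrow> \<gamma> \<noteq> 0 \<Longrightarrow> w \<gamma> v < \<gamma>"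
  using enumerations_range by blast

lemma enumerations_surj:
  assumes "enumerations w" and "\<delta> < \<gamma>"
  obtains v where "w \<gamma> v = \<delta>"
proof -
  have "\<gamma> \<noteq> 0" using assms(2) not_less_zero_omega1 by blast
  then have "\<delta> \<in> range (w \<gamma>)" using assms enumerations_range by blast
  then show ?thesis using that by blast
qed

section \<open>Instances and their extensions\<close>

lemma inj_on_new_colors: "inj_on c {i. adds_new_color c i}"
proof (rule linorder_inj_onI)
  fix i j assume "i < j" and "j \<in> {i. adds_new_color c i}"
  then show "c i \<noteq> c j" by (metis adds_new_color_def imageI lessThan_iff mem_Collect_eq)
qed (simp add: linear)

text \<open>
  Every color has a first occurrence. So the number of announcements of an instance is both the
  number of its colors and the number of its new-color indices.
\<close>

lemma image_new_colors: "c ` {i. adds_new_color c i} = range c"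
proof -
  have "c i \<in> c ` {i. adds_new_color c i}" for i
  proof (induction i rule: less_induct)
    case (less i)
    then show ?case
      by (cases "adds_new_color c i") (auto simp: adds_new_color_def image_iff)
  qed
  then show ?thesis by blast
qed

lemma finite_new_colors: "finite (range c) \<Longrightarrow> finite {i. adds_new_color c i}"
  using finite_imageD[OF _ inj_on_new_colors] image_new_colors by metis

lemma card_new_colors: "card {i. adds_new_color c i} = card (range c)"
  using card_image[OF inj_on_new_colors, of c] by (simp add: image_new_colors)

lemma adds_new_color_cong: "prefix L c' = prefix L c \<Longrightarrow> i < L \<Longrightarrow>
   adds_new_color c' i \<longleftrightarrow> adds_new_color c i"
  by (auto simp: adds_new_color_def prefix_eq_iff image_iff)

text \<open>
  The body of \<^const>\<open>name_of\<close>, with the blocks and the announced numbers as parameters: the announced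
  numbers determine the remaining budget of the instance.
\<close>

definition name_parts ::
  "(omega1 \<Rightarrow> nat \<Rightarrow> omega1) \<Rightarrow> omega1 \<Rightarrow> nat word \<Rightarrow> nat list list \<Rightarrow> nat list \<Rightarrow> nat word \<Rightarrow> bool"
  where "name_parts w \<alpha> c \<theta>s vs r \<longleftrightarrow>
    finite (range c) \<and> length \<theta>s = card (range c) \<and> length vs = card (range c) \<and>
    vs \<in> dom (descent w \<alpha>) \<and> c = concat \<theta>s \<frown> r \<and>
    (\<forall>i < card (range c). concat (take (Suc i) \<theta>s) =
      prefix (Suc (sorted_list_of_set {i. adds_new_color c i} ! i)) c)"

lemma name_of_iff:
  "name_of w \<alpha> c p \<longleftrightarrow> (\<exists>\<theta>s vs r. name_parts w \<alpha> c \<theta>s vs r \<and> p = code \<theta>s vs \<frown> (Suc \<circ> r))"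
  unfolding name_of_def name_parts_def Let_def encode_interleave by blast

text \<open>
  \<open>\<delta>\<close> is the ordinal with which the last color was announced, so further colors can be announced
  with any ordinal below \<open>\<delta>\<close>. For \<open>\<alpha> = \<nat>\<close> nothing is announced, new colors are free, and every
  budget is granted.
\<close>

fun instance_with_budget ::
  "(omega1 \<Rightarrow> nat \<Rightarrow> omega1) \<Rightarrow> param \<Rightarrow> omega1 \<Rightarrow> nat word \<Rightarrow> nat word \<Rightarrow> bool"
  where
    "instance_with_budget w (Ordinal \<alpha>) \<delta> c p \<longleftrightarrow>
      (\<exists>\<theta>s vs r. name_parts w \<alpha> c \<theta>s vs r \<and> p = code \<theta>s vs \<frown> (Suc \<circ> r) \<and> foldl w \<alpha> vs = \<delta>)"
  | "instance_with_budget w Naturals \<delta> c p \<longleftrightarrow> finite (range c) \<and> p = c"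

lemma instance_with_budget_imp_instance: "instance_with_budget w \<alpha> \<delta> c p \<Longrightarrow> is_instance w \<alpha> c p"
  by (cases \<alpha>) (auto simp: name_of_iff)

lemma finite_colors_instance: "is_instance w \<alpha> c p \<Longrightarrow> finite (range c)"
  by (cases \<alpha>) (auto simp: name_of_def)

text \<open>
  Passing from an instance to its coloring is continuous: once a segment of the name shows the first
  \<open>N\<close> letters, every name sharing this segment has the same first \<open>N\<close> colors.
\<close>

lemma instance_determines_prefix:
  assumes "is_instance w \<alpha> c p"
  obtains n where "\<And>c' p'. is_instance w \<alpha> c' p' \<Longrightarrow> prefix n p' = prefix n p \<Longrightarrow>
    prefix N c' = prefix N c"
proof (cases \<alpha>)
  case Naturals
  with assms that[of N] show ?thesis by simp
next
  case (Ordinal \<gamma>)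
  have name: "\<exists>\<theta>s vs r. length vs = length \<theta>s \<and> c' = concat \<theta>s \<frown> r \<and>
      p' = code \<theta>s vs \<frown> (Suc \<circ> r)" if "is_instance w \<alpha> c' p'" for c' p'
    using that unfolding Ordinal is_instance.simps name_of_iff name_parts_def by metis
  from name[OF assms] obtain \<theta>s vs r where len: "length vs = length \<theta>s"
    and c: "c = concat \<theta>s \<frown> r" and p: "p = code \<theta>s vs \<frown> (Suc \<circ> r)"
    by blast
  \<comment> \<open>Past the last announcement every symbol is a letter, so \<open>N\<close> more symbols suffice.\<close>
  let ?n = "length (code \<theta>s vs) + N"
  have dec: "letters (prefix ?n p) = concat \<theta>s @ prefix N r"
    unfolding p using letters_prefix_eventually[OF len, of ?n r] by simp
  have long: "N \<le> length (letters (prefix ?n p))"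
    unfolding dec by simp
  have cut: "prefix N c' = take N (letters (prefix ?n p))"
    if "is_instance w \<alpha> c' p'" and eq: "prefix ?n p' = prefix ?n p" for c' p'
  proof -
    from name[OF that(1)] obtain \<theta>s' vs' r' where len': "length vs' = length \<theta>s'"
      and c': "c' = concat \<theta>s' \<frown> r'" and p': "p' = code \<theta>s' vs' \<frown> (Suc \<circ> r')"
      by blast
    obtain zs x where x: "c' = (letters (prefix ?n p') @ zs) \<frown> x"
      using letters_prefix[OF len', of r' ?n] unfolding c' p' by metis
    show ?thesis unfolding x eq using long by simp
  qed
  show ?thesis
    by (rule that[of ?n]) (simp add: cut[OF assms refl] cut)
qed

text \<open>
  The opponent starts with one color, announced with exactly \<open>\<beta>\<close>; this is where \<open>\<beta> < \<alpha>\<close> is needed.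
\<close>

lemma constant_instance_exists:
  assumes w: "enumerations w" and "below_param \<beta> \<alpha>"
  shows "\<exists>p. instance_with_budget w \<alpha> \<beta> (\<lambda>_. 0) p"
proof (cases \<alpha>)
  case Naturals
  then show ?thesis by simp
next
  case (Ordinal \<gamma>)
  with assms have "\<beta> < \<gamma>" by simp
  then obtain v where v: "w \<gamma> v = \<beta>" using enumerations_surj[OF w] by blast
  have "\<gamma> \<noteq> 0" using \<open>\<beta> < \<gamma>\<close> not_less_zero_omega1 by blast
  have "{i. adds_new_color (\<lambda>_. 0) i} = {0}"
    by (auto simp: adds_new_color_def image_iff)
  moreover have "(\<lambda>_. 0) = [0] \<frown> (\<lambda>_. 0 :: nat)" by (simp add: conc_def fun_eq_iff)
  ultimately have "name_parts w \<gamma> (\<lambda>_. 0) [[0]] [v] (\<lambda>_. 0)"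
    using \<open>\<gamma> \<noteq> 0\<close> by (simp add: name_parts_def domIff subsequence_def)
  then show ?thesis
    unfolding Ordinal instance_with_budget.simps using v
    by (intro exI[of _ "[[0]]"] exI[of _ "[v]"] exI) auto
qed

text \<open>
  The opponent's move: keep an arbitrarily long segment of the instance, then announce a fresh color
  with any ordinal below the budget and use nothing but this color from there on.
\<close>

lemma extend_instance:
  assumes w: "enumerations w" and inst: "instance_with_budget w \<alpha> \<delta> c p" and "\<delta>' < \<delta>"
  obtains b c' p' M where "instance_with_budget w \<alpha> \<delta>' c' p'" and "b \<notin> range c"
    and "prefix N c' = prefix N c" and "prefix N p' = prefix N p" and "\<And>i. M \<le> i \<Longrightarrow> c' i = b"
proof -
  have fin: "finite (range c)"
    using finite_colors_instance instance_with_budget_imp_instance inst by blast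
  then obtain b where b: "b \<notin> range c"
    using ex_new_if_finite infinite_UNIV_nat by blast
  show ?thesis
  proof (cases \<alpha>)
    case Naturals
    let ?c = "prefix N c \<frown> (\<lambda>_. b)"
    have "range ?c \<subseteq> insert b (range c)" by (auto simp: subsequence_def)
    then have "finite (range ?c)" using fin finite_subset by blast
    then show ?thesis
      using that[of ?c ?c b N] Naturals inst b by simp
  next
    case (Ordinal \<gamma>)
    with inst obtain \<theta>s vs r where parts: "name_parts w \<gamma> c \<theta>s vs r"
      and p: "p = code \<theta>s vs \<frown> (Suc \<circ> r)" and \<delta>: "foldl w \<gamma> vs = \<delta>"
      unfolding Ordinal instance_with_budget.simps by blast
    from parts have len: "length \<theta>s = card (range c)" "length vs = length \<theta>s"
      and vs: "vs \<in> dom (descent w \<gamma>)" and c: "c = concat \<theta>s \<frown> r"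
      and blocks: "\<And>i. i < card (range c) \<Longrightarrow> concat (take (Suc i) \<theta>s) =
        prefix (Suc (sorted_list_of_set {i. adds_new_color c i} ! i)) c"
      unfolding name_parts_def by simp_all
    obtain v where v: "w \<delta> v = \<delta>'" using enumerations_surj[OF w \<open>\<delta>' < \<delta>\<close>] by blast
    let ?A = "{i. adds_new_color c i}"
    have finA: "finite ?A" using fin by (rule finite_new_colors)
    \<comment> \<open>The switch has to come after all new-color indices of \<open>c\<close>, so that the announcements of
        the old instance stay where they are and the fresh color comes last.\<close>
    define m where "m = N + Suc (Max (insert 0 ?A))"
    define L where "L = length (concat \<theta>s) + m"
    have less_m: "i < m" if "i \<in> ?A" for i
      using finA that by (auto simp: m_def less_Suc_eq_le intro!: trans_le_add2 Max_ge)
    then have A_L: "i < L" if "i \<in> ?A" for i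
      using that by (auto simp: L_def intro: trans_less_add2)
    define c' where "c' = prefix L c \<frown> (\<lambda>_. b)"
    define \<theta> where "\<theta> = prefix m r @ [b]"
    define p' where "p' = code (\<theta>s @ [\<theta>]) (vs @ [v]) \<frown> (Suc \<circ> (\<lambda>_. b))"
    have c_L: "prefix L c = concat \<theta>s @ prefix m r"
      unfolding L_def c by simp
    have c'_b: "c' i = b" if "L \<le> i" for i
      using that by (simp add: c'_def)
    have c'_c: "c' i = c i" if "i < L" for i
      using that by (simp add: c'_def)
    have range_c: "range c \<subseteq> c' ` {..<L}"
      using A_L c'_c by (subst image_new_colors[symmetric]) force
    have range_c': "range c' = insert b (range c)"
    proof -
      have "range c' \<subseteq> insert b (range c)" using c'_b c'_c by (metis image_subsetI insertCI not_le rangeI)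
      moreover have "b \<in> range c'" using c'_b by (metis order_refl rangeI)
      ultimately show ?thesis using range_c by blast
    qed
    have card_c': "card (range c') = Suc (card (range c))"
      using fin b by (simp add: range_c')
    have "adds_new_color c' i \<longleftrightarrow> i = L \<or> i \<in> ?A" for i
    proof (cases i L rule: linorder_cases)
      case less
      then have "adds_new_color c' i \<longleftrightarrow> adds_new_color c i"
        by (intro adds_new_color_cong) (auto simp: prefix_eq_iff c'_c)
      with less show ?thesis by auto
    next
      case equal
      have "b \<notin> c' ` {..<L}" using b c'_c by auto
      with equal show ?thesis by (simp add: adds_new_color_def c'_b)
    next
      case greater
      then have "c' i = c' L" by (simp add: c'_b)
      then have "\<not> adds_new_color c' i" using greater by (auto simp: adds_new_color_def)
      with greater A_L[of i] show ?thesis by auto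
    qed
    then have A': "{i. adds_new_color c' i} = insert L ?A" by auto
    have sorted: "sorted_list_of_set (insert L ?A) = sorted_list_of_set ?A @ [L]"
    proof -
      have "set (sorted_list_of_set ?A @ [L]) = insert L ?A" using finA by simp
      moreover have "sorted (sorted_list_of_set ?A @ [L])" "distinct (sorted_list_of_set ?A @ [L])"
        using finA A_L by (auto simp: sorted_append order_less_imp_le)
      ultimately show ?thesis
        using sorted_list_of_set.idem_if_sorted_distinct by metis
    qed
    have len_sorted: "length (sorted_list_of_set ?A) = card (range c)"
      by (simp add: card_new_colors)
    have blocks': "concat (take (Suc i) (\<theta>s @ [\<theta>])) =
        prefix (Suc (sorted_list_of_set {i. adds_new_color c' i} ! i)) c'"
      if "i < card (range c')" for i
    proof (cases "i < card (range c)")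
      case True
      let ?j = "sorted_list_of_set ?A ! i"
      have "?j \<in> ?A" using True len_sorted finA nth_mem by (metis set_sorted_list_of_set)
      then have "Suc ?j \<le> L" by (rule Suc_leI[OF A_L])
      then have "prefix (Suc ?j) c' = prefix (Suc ?j) c"
        unfolding prefix_eq_iff using c'_c by auto
      then show ?thesis
        using True blocks[OF True] len len_sorted by (simp add: A' sorted nth_append)
    next
      case False
      then have i: "i = card (range c)" using that card_c' by simp
      have "prefix (Suc L) c' = prefix L c @ [b]"
        by (simp add: c'_def)
      then show ?thesis
        using i len len_sorted by (simp add: A' sorted nth_append c_L \<theta>_def)
    qed
    have c'_eq: "c' = concat (\<theta>s @ [\<theta>]) \<frown> (\<lambda>_. b)"
    proof -
      have "(\<lambda>_. b) = [b] \<frown> (\<lambda>_. b)" by (simp add: conc_def fun_eq_iff)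
      then have "c' = (prefix L c @ [b]) \<frown> (\<lambda>_. b)" unfolding c'_def by (metis conc_conc)
      then show ?thesis by (simp add: c_L \<theta>_def)
    qed
    have "\<delta> \<noteq> 0" using \<open>\<delta>' < \<delta>\<close> not_less_zero_omega1 by blast
    then have "vs @ [v] \<in> dom (descent w \<gamma>)"
      by (simp add: descent_snoc_iff vs \<delta>)
    then have "name_parts w \<gamma> c' (\<theta>s @ [\<theta>]) (vs @ [v]) (\<lambda>_. b)"
      unfolding name_parts_def using fin len card_c' blocks' c'_eq by (simp add: range_c')
    then have 1: "instance_with_budget w \<alpha> \<delta>' c' p'"
      unfolding Ordinal instance_with_budget.simps p'_def using v \<delta>
      by (intro exI[of _ "\<theta>s @ [\<theta>]"] exI[of _ "vs @ [v]"] exI[of _ "\<lambda>_. b"]) simp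
    have "N \<le> L" "N \<le> m" by (simp_all add: L_def m_def)
    have 2: "prefix N c' = prefix N c"
      unfolding prefix_eq_iff using c'_c \<open>N \<le> L\<close> by auto
    have "prefix N p' = prefix N p"
    proof -
      have eq: "Suc \<circ> r = map Suc (prefix m r) \<frown> (Suc \<circ> suffix m r)"
        by (metis comp_concat prefix_suffix)
      have "p = (code \<theta>s vs @ map Suc (prefix m r)) \<frown> (Suc \<circ> suffix m r)"
        unfolding p by (subst eq) simp
      moreover have "p' = (code \<theta>s vs @ map Suc (prefix m r)) \<frown> ([Suc b, 0, Suc v] \<frown> (Suc \<circ> (\<lambda>_. b)))"
        unfolding p'_def code_snoc[OF len(2)] \<theta>_def conc_conc by simp
      ultimately show ?thesis using \<open>N \<le> m\<close> by (simp del: comp_concat)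
    qed
    then show ?thesis using that[OF 1 b 2] c'_b by blast
  qed
qed

section \<open>Solutions\<close>

text \<open>
  Stated with \<^term>\<open>Suc 0\<close> because this is the form to which the simplifier brings the exponent 1.
\<close>

lemma colors_of_one: "colors_of (Suc 0) enc c A = (\<lambda>x. c (enc {x})) ` A"
  by (simp add: colors_of_def nsets_one image_image)

lemma colors_of_one_cong:
  obtains N where "\<And>c c' X. prefix N c' = prefix N c \<Longrightarrow> X \<subseteq> {..<n} \<Longrightarrow>
    colors_of 1 enc c' X = colors_of 1 enc c X"
proof -
  define N where "N = Suc (Max (insert 0 ((\<lambda>x. enc {x}) ` {..<n})))"
  have "enc {x} < N" if "x < n" for x
    using that by (auto simp: N_def less_Suc_eq_le intro!: Max_ge)
  then show ?thesis
    by (intro that[of N]) (auto simp: prefix_eq_iff colors_of_one intro!: image_cong)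
qed

lemma string_set_subset: "string_set \<phi> \<subseteq> {..<length \<phi>}"
  by (auto simp: string_set_def)

lemma finite_string_set: "finite (string_set \<phi>)"
  by (rule finite_subset[OF string_set_subset]) simp

lemma string_set_append_subset: "string_set \<phi> \<subseteq> string_set (\<phi> @ \<psi>)"
  by (auto simp: string_set_def nth_append)

lemma string_set_subset_indicator: "\<phi> \<frown> x = indicator A \<Longrightarrow> string_set \<phi> \<subseteq> A"
proof
  fix i assume eq: "\<phi> \<frown> x = indicator A" and "i \<in> string_set \<phi>"
  then have "indicator A i = (1 :: nat)" unfolding eq[symmetric] by (simp add: string_set_def)
  then show "i \<in> A" by (rule contrapos_pp) simp
qed

lemma dom_RT: "p \<in> dom (RT n enc w \<alpha> \<beta>) \<longleftrightarrow> (\<exists>c. is_instance w \<alpha> c p)"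
  by (auto simp: RT_def domIff)

lemma the_RT:
  assumes "is_instance w \<alpha> c p"
  shows "the (RT n enc w \<alpha> \<beta> p) = {y. is_solution n enc w \<beta> c y}"
proof -
  have "is_instance w \<alpha> c' p \<longleftrightarrow> c' = c" for c'
    using assms is_instance_unique by blast
  then show ?thesis by (simp add: RT_def)
qed

lemma is_solution_iff:
  "is_solution n enc w \<beta> c y \<longleftrightarrow>
    (\<exists>\<phi>s vs q A. length vs = length \<phi>s \<and> y = code \<phi>s vs \<frown> (Suc \<circ> q) \<and>
      concat \<phi>s \<frown> q = indicator A \<and> infinite A \<and>
      card (colors_of n enc c A) \<le> length \<phi>s \<and> vs \<in> dom (descent w \<beta>) \<and>
      (\<forall>i \<le> length \<phi>s. card (colors_of n enc c (string_set (concat (take i \<phi>s)))) \<le> i))"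
  unfolding is_solution_def encode_interleave by metis

section \<open>The opponent copies the announced ordinals\<close>

text \<open>
  The opponent wins by repeating the solver's announcements. The invariant: the coloring ends with
  a constant tail of color \<open>b\<close>, the solver has put at least \<open>j\<close> other colors into her set, and the
  opponent's budget is the ordinal of the solver's \<open>j\<close>-th announcement (\<open>\<beta>\<close> if \<open>j = 0\<close>). As her set
  is infinite, it will contain the color \<open>b\<close> as well, which forces a further announcement, with an
  ordinal \<open>\<delta>' < \<delta>\<close>. When both the announcement and an element of color \<open>b\<close> are on the table, the
  opponent announces a fresh color with the same \<open>\<delta>'\<close> and makes it the new tail, which restores the
  invariant for \<open>j + 1\<close>. If \<open>\<delta> = 0\<close>, the forced announcement is impossible and there is no solution.

  Announcements made by the solver in advance do not help her: only the first \<open>j\<close> of them count, and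
  the opponent spends his budget at the same rate.
\<close>

lemma obstructed_RT:
  fixes enc :: "nat set \<Rightarrow> nat"
  assumes enc: "bij_betw enc (nsets UNIV 1) UNIV" and w: "enumerations w"
    and inst: "instance_with_budget w \<alpha> \<delta> c p"
    and tail: "\<And>i. M \<le> i \<Longrightarrow> c i = b"
    and seen: "j \<le> card (colors_of 1 enc c (string_set (letters \<rho>)))"
    and fresh: "b \<notin> colors_of 1 enc c (string_set (letters \<rho>))"
    and announced: "j \<le> length (announcements \<rho>)"
      "foldl w \<beta> (take j (announcements \<rho>)) = \<delta>"
  shows "obstructed (RT 1 enc w \<alpha> \<beta>) (cylinder \<rho>) \<delta> p"
  using assms(3-)
proof (induction \<delta> arbitrary: c p M b j \<rho> rule: less_induct)
  case (less \<delta>)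
  let ?P = "RT 1 enc w \<alpha> \<beta>"
  have p: "is_instance w \<alpha> c p"
    using less.prems(1) by (rule instance_with_budget_imp_instance)
  show ?case
  proof (rule obstructed.intros)
    fix y assume "y \<in> the (?P p) \<inter> cylinder \<rho>"
    then obtain \<phi>s vs q A where len: "length vs = length \<phi>s"
      and y: "y = code \<phi>s vs \<frown> (Suc \<circ> q)" and A: "concat \<phi>s \<frown> q = indicator A" "infinite A"
      and few: "card (colors_of 1 enc c A) \<le> length \<phi>s" and vs: "vs \<in> dom (descent w \<beta>)"
      and \<rho>y: "prefix (length \<rho>) y = \<rho>"
      unfolding the_RT[OF p] is_solution_iff Int_iff mem_Collect_eq cylinder_def
        initial_segment_def by blast
    obtain zs x where "concat \<phi>s \<frown> q = (letters \<rho> @ zs) \<frown> x"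
      using letters_prefix[OF len, where r = q and n = "length \<rho>"] unfolding y[symmetric] \<rho>y by metis
    then have sub: "string_set (letters \<rho>) \<subseteq> A"
      using A(1) string_set_append_subset string_set_subset_indicator by (metis subset_trans)
    obtain us where us: "vs = announcements \<rho> @ us"
      using announcements_prefix[OF len, where r = q and n = "length \<rho>"] unfolding y[symmetric] \<rho>y by metis
    have inj: "inj (\<lambda>x. enc {x})"
      using enc by (auto simp: bij_betw_def nsets_one inj_on_def)
    \<comment> \<open>Injectivity of the indexing carries the infinite set \<open>A\<close> into the tail of \<open>c\<close>.\<close>
    obtain a where a: "a \<in> A" "c (enc {a}) = b"
    proof -
      have "infinite ((\<lambda>x. enc {x}) ` A)"
        using A(2) inj by (meson finite_imageD inj_on_subset subset_UNIV)
      then obtain i where "M \<le> i" "i \<in> (\<lambda>x. enc {x}) ` A"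
        using infinite_nat_iff_unbounded_le by blast
      then show ?thesis using that less.prems(2) by blast
    qed
    have finA: "finite (colors_of 1 enc c A)"
      using finite_colors_instance[OF p] by (rule finite_subset[rotated]) (auto simp: colors_of_one)
    have j_less: "j < length vs"
    proof -
      let ?C = "colors_of 1 enc c (string_set (letters \<rho>))"
      have "?C \<subseteq> colors_of 1 enc c A" "b \<in> colors_of 1 enc c A"
        using sub a by (auto simp: colors_of_one)
      then have "insert b ?C \<subseteq> colors_of 1 enc c A" by blast
      then have "card (insert b ?C) \<le> card (colors_of 1 enc c A)"
        using finA by (rule card_mono[rotated])
      moreover have "finite ?C" using finite_string_set by (simp add: colors_of_one)
      ultimately show ?thesis
        using less.prems(3,4) few len by simp
    qed
    define \<delta>' where "\<delta>' = w \<delta> (vs ! j)"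
    have take_j: "take j vs = take j (announcements \<rho>)"
      using us less.prems(5) by simp
    then have fold_j: "foldl w \<beta> (take j vs) = \<delta>" using less.prems(6) by simp
    have take_Suc: "take (Suc j) vs = take j vs @ [vs ! j]"
      using j_less by (rule take_Suc_conv_app_nth)
    have "take (Suc j) vs \<in> dom (descent w \<beta>)"
      using vs descent_append_dom[of "take (Suc j) vs" "drop (Suc j) vs"] by simp
    then have "\<delta> \<noteq> 0" unfolding take_Suc descent_snoc_iff fold_j by blast
    then have "\<delta>' < \<delta>" unfolding \<delta>'_def by (rule enumerations_less[OF w])
    have fold': "foldl w \<beta> (take (Suc j) vs) = \<delta>'"
      unfolding take_Suc by (simp add: fold_j \<delta>'_def)

    \<comment> \<open>Long enough to extend \<open>\<rho>\<close>, to show all announcements and to decide whether \<open>a\<close> belongs to \<open>A\<close>.\<close>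
    define n where "n = length \<rho> + length (code \<phi>s vs) + Suc a"
    define \<rho>' where "\<rho>' = prefix n y"
    have \<rho>': "\<rho>' \<sqsubseteq> y" by (auto simp: \<rho>'_def initial_segment_iff_prefix)
    have ann': "announcements \<rho>' = vs"
      unfolding \<rho>'_def y by (rule announcements_prefix_eventually[OF len]) (simp add: n_def)
    have dec': "letters \<rho>' = concat \<phi>s @ prefix (n - length (code \<phi>s vs)) q"
      unfolding \<rho>'_def y by (rule letters_prefix_eventually[OF len]) (simp add: n_def)
    have a': "a \<in> string_set (letters \<rho>')"
    proof -
      have "indicator A = letters \<rho>' \<frown> suffix (n - length (code \<phi>s vs)) q"
        unfolding A(1)[symmetric] dec' by (metis conc_conc prefix_suffix)
      moreover have "a < length (letters \<rho>')" unfolding dec' n_def by simp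
      ultimately have "letters \<rho>' ! a = indicator A a" by simp
      then show ?thesis using \<open>a < length (letters \<rho>')\<close> a(1) by (simp add: string_set_def)
    qed
    have "string_set (letters \<rho>) \<subseteq> string_set (letters \<rho>')"
    proof -
      have "prefix (length \<rho> + (length (code \<phi>s vs) + Suc a)) y = \<rho>' " by (simp add: \<rho>'_def n_def add.assoc)
      then obtain ys where "\<rho>' = \<rho> @ ys" using prefix_add_ex \<rho>y by metis
      then show ?thesis using letters_append string_set_append_subset by metis
    qed
    then have sub': "insert b (colors_of 1 enc c (string_set (letters \<rho>))) \<subseteq>
        colors_of 1 enc c (string_set (letters \<rho>'))"
      using a' a(2) by (auto simp: colors_of_one)
    have seen': "Suc j \<le> card (colors_of 1 enc c (string_set (letters \<rho>')))"
    proof -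
      have "card (insert b (colors_of 1 enc c (string_set (letters \<rho>)))) \<le>
          card (colors_of 1 enc c (string_set (letters \<rho>')))"
        by (rule card_mono[OF _ sub']) (simp add: colors_of_one finite_string_set)
      then show ?thesis
        using less.prems(3,4) by (simp add: colors_of_one finite_string_set)
    qed
    have cyl: "cylinder \<rho> \<inter> cylinder \<rho>' \<subseteq> cylinder \<rho>'" by blast

    show "\<exists>\<rho>'. \<rho>' \<sqsubseteq> y \<and> (\<forall>\<sigma>. \<sigma> \<sqsubseteq> p \<longrightarrow> (\<exists>p' \<in> dom ?P \<inter> cylinder \<sigma>. p' \<noteq> p \<and>
        (\<exists>\<delta>' < \<delta>. obstructed ?P (cylinder \<rho> \<inter> cylinder \<rho>') \<delta>' p')))"
    proof (intro exI[of _ \<rho>'] conjI \<rho>' allI impI)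
      fix \<sigma> assume "\<sigma> \<sqsubseteq> p"
      then obtain m where \<sigma>: "\<sigma> = prefix m p" by (auto simp: initial_segment_iff_prefix)
      obtain N where N: "\<And>c c' X. prefix N c' = prefix N c \<Longrightarrow> X \<subseteq> {..<length (letters \<rho>')} \<Longrightarrow>
          colors_of 1 enc c' X = colors_of 1 enc c X"
        using colors_of_one_cong by blast
      obtain b' c' p' M' where inst': "instance_with_budget w \<alpha> \<delta>' c' p'" and b': "b' \<notin> range c"
        and c': "prefix (m + N) c' = prefix (m + N) c" and p': "prefix (m + N) p' = prefix (m + N) p"
        and tail': "\<And>i. M' \<le> i \<Longrightarrow> c' i = b'"
        by (rule extend_instance[OF w less.prems(1) \<open>\<delta>' < \<delta>\<close>, where N = "m + N"]) (rule that)
      have same: "colors_of 1 enc c' (string_set (letters \<rho>')) =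
          colors_of 1 enc c (string_set (letters \<rho>'))"
        using prefix_cong_le[OF c', of N] string_set_subset by (intro N) auto
      have ip': "is_instance w \<alpha> c' p'"
        using inst' by (rule instance_with_budget_imp_instance)
      have "obstructed ?P (cylinder \<rho>') \<delta>' p'"
      proof (rule less.IH[OF \<open>\<delta>' < \<delta>\<close> inst' tail'])
        show "Suc j \<le> card (colors_of 1 enc c' (string_set (letters \<rho>')))"
          unfolding same by (rule seen')
        show "b' \<notin> colors_of 1 enc c' (string_set (letters \<rho>'))"
          unfolding same using b' by (auto simp: colors_of_one)
        show "Suc j \<le> length (announcements \<rho>')" using j_less ann' by simp
        show "foldl w \<beta> (take (Suc j) (announcements \<rho>')) = \<delta>'" using fold' ann' by simp
      qed
      then have "obstructed ?P (cylinder \<rho> \<inter> cylinder \<rho>') \<delta>' p'"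
        using cyl by (rule obstructed_antimono)
      moreover have "p' \<noteq> p"
      proof
        assume "p' = p"
        then have "c' = c" using is_instance_unique p ip' by blast
        then show False using tail'[of M'] b' by blast
      qed
      moreover have "p' \<in> cylinder \<sigma>"
        unfolding \<sigma> cylinder_prefix_iff using p' by (rule prefix_cong_le) simp
      moreover have "p' \<in> dom ?P" using ip' by (auto simp: dom_RT)
      ultimately show "\<exists>p' \<in> dom ?P \<inter> cylinder \<sigma>. p' \<noteq> p \<and>
          (\<exists>\<delta>' < \<delta>. obstructed ?P (cylinder \<rho> \<inter> cylinder \<rho>') \<delta>' p')"
        using \<open>\<delta>' < \<delta>\<close> by blast
    qed
  qed
qed

section \<open>The solver outlasts every smaller rank\<close>

text \<open>
  The solver wins against every \<open>\<gamma>\<close> below her remaining budget, from any position in which the number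
  of colors used does not exceed the number of announcements made. She announces \<open>\<gamma>\<close> itself, which
  entitles her to one more color, and continues with all elements of one color class that is
  infinite under the current coloring. The opponent's answer keeps the coloring on the part of her
  set that is already fixed and leaves him with some \<open>\<delta> < \<gamma>\<close>, so the same kind of position recurs,
  now with budget \<open>\<gamma>\<close>. However many colors he introduces, one infinite class is enough for her.
\<close>

lemma not_obstructed_RT:
  fixes enc :: "nat set \<Rightarrow> nat"
  assumes w: "enumerations w"
    and p: "is_instance w \<alpha> c p"
    and len: "length vs = length \<phi>s"
    and bits: "set (concat \<phi>s @ \<psi>) \<subseteq> {0, 1}"
    and vs: "vs \<in> dom (descent w \<beta>)"
    and few: "\<And>i. i \<le> length \<phi>s \<Longrightarrow>
      card (colors_of 1 enc c (string_set (concat (take i \<phi>s)))) \<le> i"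
    and few_end: "card (colors_of 1 enc c (string_set (concat \<phi>s @ \<psi>))) \<le> length \<phi>s"
    and less: "\<gamma> < foldl w \<beta> vs"
  shows "\<not> obstructed (RT 1 enc w \<alpha> \<beta>) (cylinder (code \<phi>s vs @ map Suc \<psi>)) \<gamma> p"
  using assms(2-)
proof (induction \<gamma> arbitrary: c p \<phi>s vs \<psi> rule: less_induct)
  case (less \<gamma>)
  note p = less.prems(1) and len = less.prems(2) and bits = less.prems(3)
    and vs = less.prems(4) and few = less.prems(5) and few_end = less.prems(6)
  let ?P = "RT 1 enc w \<alpha> \<beta>" and ?l = "length (concat \<phi>s @ \<psi>)"
  obtain v where v: "w (foldl w \<beta> vs) v = \<gamma>"
    using enumerations_surj[OF w less.prems(7)] by blast
  have "foldl w \<beta> vs \<noteq> 0" using less.prems(7) not_less_zero_omega1 by metis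
  then have vs': "vs @ [v] \<in> dom (descent w \<beta>)" using vs by (simp add: descent_snoc_iff)
  have fold': "foldl w \<beta> (vs @ [v]) = \<gamma>" using v by simp
  obtain b where b: "infinite {x. c (enc {x}) = b}"
  proof -
    have "finite (range (\<lambda>x. c (enc {x})))"
      using finite_colors_instance[OF p] by (rule finite_subset[rotated]) auto
    then show ?thesis
      using pigeonhole_infinite[of UNIV "\<lambda>x. c (enc {x})"] that by auto
  qed
  define S where "S = {x. ?l \<le> x \<and> c (enc {x}) = b}"
  define A where "A = string_set (concat \<phi>s @ \<psi>) \<union> S"
  define q where "q = (\<lambda>i. indicator S (?l + i) :: nat)"
  define \<phi>s' where "\<phi>s' = \<phi>s @ [\<psi>]"
  define y where "y = code \<phi>s' (vs @ [v]) \<frown> (Suc \<circ> q)"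
  have len': "length (vs @ [v]) = length \<phi>s'" using len by (simp add: \<phi>s'_def)
  have concat': "concat \<phi>s' = concat \<phi>s @ \<psi>" by (simp add: \<phi>s'_def)
  have "infinite S"
  proof -
    have "{x. c (enc {x}) = b} \<subseteq> {..<?l} \<union> S" by (auto simp: S_def not_le)
    then show ?thesis using b by (metis finite_Un finite_lessThan finite_subset)
  qed
  then have infA: "infinite A" by (simp add: A_def)
  have ind: "concat \<phi>s' \<frown> q = indicator A"
  proof (rule ext)
    fix i
    show "(concat \<phi>s' \<frown> q) i = indicator A i"
    proof (cases "i < ?l")
      case True
      then have "(concat \<phi>s @ \<psi>) ! i \<in> {0, 1}" using bits nth_mem by blast
      moreover have "i \<in> A \<longleftrightarrow> (concat \<phi>s @ \<psi>) ! i = 1"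
        using True by (auto simp: A_def S_def string_set_def)
      ultimately show ?thesis using True unfolding concat' by (auto simp: indicator_def simp del: length_append)
    next
      case False
      then have "i \<in> A \<longleftrightarrow> i \<in> S" by (auto simp: A_def string_set_def)
      then show ?thesis using False unfolding concat' by (simp add: q_def indicator_def del: length_append)
    qed
  qed
  have colA: "colors_of 1 enc c A \<subseteq> insert b (colors_of 1 enc c (string_set (concat \<phi>s @ \<psi>)))"
    by (auto simp: colors_of_one A_def S_def)
  have finC: "finite (colors_of 1 enc c (string_set \<phi>))" for \<phi>
    by (simp add: colors_of_one finite_string_set)
  have card_sub: "card (colors_of 1 enc c X) \<le> length \<phi>s'" if "X \<subseteq> A" for X
  proof -
    have "colors_of 1 enc c X \<subseteq> insert b (colors_of 1 enc c (string_set (concat \<phi>s @ \<psi>)))"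
      using that colA by (auto simp: colors_of_one)
    then have "card (colors_of 1 enc c X) \<le> card (insert b (colors_of 1 enc c (string_set (concat \<phi>s @ \<psi>))))"
      using finC by (intro card_mono) auto
    also have "\<dots> \<le> Suc (length \<phi>s)"
      using few_end finC by (simp add: card_insert_if)
    finally show ?thesis by (simp add: \<phi>s'_def)
  qed
  have few': "card (colors_of 1 enc c (string_set (concat (take i \<phi>s')))) \<le> i"
    if "i \<le> length \<phi>s'" for i
  proof (cases "i \<le> length \<phi>s")
    case True
    then show ?thesis using few by (simp add: \<phi>s'_def)
  next
    case False
    then have "i = length \<phi>s'" using that by (simp add: \<phi>s'_def)
    moreover have "string_set (concat \<phi>s') \<subseteq> A" by (simp add: A_def concat')
    ultimately show ?thesis using card_sub by simp
  qed
  have sol: "is_solution 1 enc w \<beta> c y"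
    unfolding is_solution_iff
    by (intro exI[of _ \<phi>s'] exI[of _ "vs @ [v]"] exI[of _ q] exI[of _ A])
      (use len' ind infA card_sub[OF order_refl] vs' few' in \<open>simp add: y_def\<close>)
  have y_eq: "y = (code \<phi>s vs @ map Suc \<psi>) \<frown> ([0, Suc v] \<frown> (Suc \<circ> q))"
    unfolding y_def \<phi>s'_def code_snoc[OF len] conc_conc by simp
  then have "y \<in> cylinder (code \<phi>s vs @ map Suc \<psi>)"
    unfolding cylinder_def initial_segment_def mem_Collect_eq by (simp only: prefix_conc_length)
  with sol have y: "y \<in> the (?P p) \<inter> cylinder (code \<phi>s vs @ map Suc \<psi>)"
    by (simp add: the_RT[OF p])
  show ?case
  proof
    assume "obstructed ?P (cylinder (code \<phi>s vs @ map Suc \<psi>)) \<gamma> p"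
    with y obtain \<rho> where "\<rho> \<sqsubseteq> y"
      and near: "\<And>\<sigma>. \<sigma> \<sqsubseteq> p \<Longrightarrow> \<exists>p' \<in> dom ?P \<inter> cylinder \<sigma>. p' \<noteq> p \<and> (\<exists>\<delta> < \<gamma>.
        obstructed ?P (cylinder (code \<phi>s vs @ map Suc \<psi>) \<inter> cylinder \<rho>) \<delta> p')"
      unfolding obstructed_iff[of ?P _ \<gamma> p] by blast
    then obtain n where \<rho>: "\<rho> = prefix n y" by (auto simp: initial_segment_iff_prefix)
    define \<psi>' where "\<psi>' = prefix n q"
    \<comment> \<open>The opponent may commit her to a segment that ends before or inside the announcement. The
        longer segment admits fewer solutions, so defeating him there is enough.\<close>
    let ?\<rho>' = "code \<phi>s' (vs @ [v]) @ map Suc \<psi>'"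
    have \<rho>': "?\<rho>' = prefix (length (code \<phi>s' (vs @ [v])) + n) y"
      unfolding y_def by (simp add: prefix_code \<psi>'_def) (simp add: subsequence_def)
    have sub: "cylinder ?\<rho>' \<subseteq> cylinder (code \<phi>s vs @ map Suc \<psi>) \<inter> cylinder \<rho>"
    proof -
      have "code \<phi>s vs @ map Suc \<psi> = prefix (length (code \<phi>s vs @ map Suc \<psi>)) y"
        unfolding y_eq by (simp only: prefix_conc_length)
      moreover have "length (code \<phi>s vs @ map Suc \<psi>) \<le> length (code \<phi>s' (vs @ [v])) + n"
        by (simp add: \<phi>s'_def code_snoc[OF len])
      ultimately have "cylinder ?\<rho>' \<subseteq> cylinder (code \<phi>s vs @ map Suc \<psi>)"
        unfolding \<rho>' using cylinder_prefix_antimono by metis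
      moreover have "cylinder ?\<rho>' \<subseteq> cylinder \<rho>"
        unfolding \<rho>' \<rho> by (rule cylinder_prefix_antimono) simp
      ultimately show ?thesis by blast
    qed
    have sub_A: "string_set (concat \<phi>s' @ \<psi>') \<subseteq> A"
    proof (rule string_set_subset_indicator)
      show "(concat \<phi>s' @ \<psi>') \<frown> suffix n q = indicator A"
        unfolding ind[symmetric] \<psi>'_def by (metis conc_conc prefix_suffix)
    qed
    have bits': "set (concat \<phi>s' @ \<psi>') \<subseteq> {0, 1}"
      using bits by (auto simp: concat' \<psi>'_def q_def subsequence_def indicator_def)
    obtain N where N: "\<And>c c' X. prefix N c' = prefix N c \<Longrightarrow> X \<subseteq> {..<length (concat \<phi>s' @ \<psi>')} \<Longrightarrow>
        colors_of 1 enc c' X = colors_of 1 enc c X"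
      using colors_of_one_cong by blast
    obtain m where m: "\<And>c' p'. is_instance w \<alpha> c' p' \<Longrightarrow> prefix m p' = prefix m p \<Longrightarrow>
        prefix N c' = prefix N c"
      using instance_determines_prefix[OF p] by blast
    have "prefix m p \<sqsubseteq> p" by (auto simp: initial_segment_iff_prefix)
    from near[OF this] obtain p' \<delta> where p': "p' \<in> dom ?P" "prefix m p' = prefix m p" and "\<delta> < \<gamma>"
      and obs: "obstructed ?P (cylinder (code \<phi>s vs @ map Suc \<psi>) \<inter> cylinder \<rho>) \<delta> p'"
      unfolding cylinder_prefix_iff[symmetric] by blast
    from p' obtain c' where inst': "is_instance w \<alpha> c' p'" by (auto simp: dom_RT)
    have same: "colors_of 1 enc c' X = colors_of 1 enc c X" if "X \<subseteq> {..<length (concat \<phi>s' @ \<psi>')}" for X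
      using N m[OF inst' p'(2)] that by blast
    have same_take: "colors_of 1 enc c' (string_set (concat (take i \<phi>s'))) =
        colors_of 1 enc c (string_set (concat (take i \<phi>s')))" for i
    proof (rule same)
      have "concat \<phi>s' @ \<psi>' = concat (take i \<phi>s') @ concat (drop i \<phi>s') @ \<psi>'"
        by (metis append.assoc append_take_drop_id concat_append)
      then have "length (concat (take i \<phi>s')) \<le> length (concat \<phi>s' @ \<psi>')" by simp
      then show "string_set (concat (take i \<phi>s')) \<subseteq> {..<length (concat \<phi>s' @ \<psi>')}"
        using string_set_subset by (metis lessThan_subset_iff subset_trans)
    qed
    have "\<not> obstructed ?P (cylinder ?\<rho>') \<delta> p'"
    proof (rule less.IH[OF \<open>\<delta> < \<gamma>\<close> inst' len' bits' vs'])
      show "card (colors_of 1 enc c' (string_set (concat (take i \<phi>s')))) \<le> i"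
        if "i \<le> length \<phi>s'" for i
        unfolding same_take using that by (rule few')
      show "card (colors_of 1 enc c' (string_set (concat \<phi>s' @ \<psi>'))) \<le> length \<phi>s'"
        unfolding same[OF string_set_subset] using sub_A by (rule card_sub)
      show "\<delta> < foldl w \<beta> (vs @ [v])" unfolding fold' by (rule \<open>\<delta> < \<gamma>\<close>)
    qed
    with obstructed_antimono[OF obs sub] show False by blast
  qed
qed

section \<open>The rank of the problem\<close>

theorem theorem5p2p2:
  fixes enc :: "nat set \<Rightarrow> nat"
    and w :: "omega1 \<Rightarrow> nat \<Rightarrow> omega1"
    and \<alpha> :: param
    and \<beta> :: omega1
  assumes enc: "bij_betw enc (nsets UNIV 1) UNIV"
    and w: "enumerations w"
    and less: "below_param \<beta> \<alpha>"
  shows "has_rank_discontinuity (RT 1 enc w \<alpha> \<beta>) \<beta> \<and>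
    (\<forall>\<gamma> < \<beta>. \<not> has_rank_discontinuity (RT 1 enc w \<alpha> \<beta>) \<gamma>)"
proof -
  let ?P = "RT 1 enc w \<alpha> \<beta>"
  have cyl: "cylinder [] = UNIV" by (simp add: cylinder_def initial_segment_def)
  have low: "\<not> obstructed ?P UNIV \<gamma> p" if "\<gamma> < \<beta>" and p: "p \<in> dom ?P" for \<gamma> p
  proof -
    obtain c where "is_instance w \<alpha> c p" using p by (auto simp: dom_RT)
    from not_obstructed_RT[OF w this, of "[]" "[]" "[]" \<beta> enc \<gamma>] that(1) cyl show ?thesis
      by (simp add: code_def string_set_def colors_of_one domIff)
  qed
  obtain p where p: "instance_with_budget w \<alpha> \<beta> (\<lambda>_. 0) p"
    using constant_instance_exists[OF w less] by blast
  have "obstructed ?P (cylinder []) \<beta> p"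
    by (rule obstructed_RT[OF enc w p, of 0 0 0]) (simp_all add: string_set_def colors_of_one)
  moreover have "p \<in> dom ?P"
    using instance_with_budget_imp_instance[OF p] by (auto simp: dom_RT)
  ultimately have "rank_discontinuity ?P p \<beta>"
    using low by (simp add: rank_discontinuity_iff_least_obstructed cyl)
  then show ?thesis
    using low by (auto simp: has_rank_discontinuity_def rank_discontinuity_iff_least_obstructed)
qed

end
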